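(* Let $v_t(z_{0:t-1}\mid x_{1:t})$, $t=0,\dots,T$, be the value process of the risk-averse multistage problem with cost function $Q\colon\mathcal Z_{0:T}\times\Xi_{1:T}\to\mathbb R\cup\{\infty\}$ and optimal value $v_0^*:=\inf_{z_{0:T}\lhd\mathcal F_{0:T}}\mathcal R_{\mathcal S_{1:T}}\bigl(Q(z_{0:T}(\cdot);\cdot)\bigr)$, as defined in the context. Then $$v_0^*=\inf_{z_{0:t-1}\lhd\mathcal F_{0:t-1}}\mathcal R_{\mathcal S_{1:t}}\bigl(v_t(z_{0:t-1}\mid\cdot)\bigr),\qquad t\in\{0,1,\dots,T\}.$$ More generally, for $s<t$ and any adapted $z_{0:s-1}$, the recursive equations $$v_s(z_{0:s-1}\mid x_{1:s})=\inf_{z_{s:t-1}\lhd\mathcal F_{s:t-1}}\mathcal R_{\mathcal S_{s+1:t}}\bigl(v_t(z_{0:s-1},z_{s:t-1}\mid\cdot)\,\bigm|\,x_{1:s}\bigr)$$ hold.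
   Context: Spaces: $T\ge1$; $\Xi_t$, $t=1,\dots,T$, are Polish spaces; $\Xi=\Xi_{1:T}:=\Xi_1\times\dots\times\Xi_T$, elements $x_{1:T}=(x_1,\dots,x_T)$, $x_{1:t}=(x_1,\dots,x_t)$, $x_{1:0}$ the empty tuple; $P$ is a Borel probability measure on $\Xi$; $\mathcal F_t$ is the sigma algebra generated by $x\mapsto x_{1:t}$, $\mathcal F_0$ trivial; $P(\cdot\mid x_{1:t})$ is the regular conditional probability on $\Xi_{t+1}\times\dots\times\Xi_T$ given the first $t$ coordinates. Risk functionals: a distortion function is a nondecreasing $\sigma\colon[0,1)\to[0,\infty)$ with $\int_0^1\sigma(u)\,du=1$. For $\alpha\in[0,1)$, $\mathsf{AV@R}_{\alpha;P}(Y):=\inf_{c\in\mathbb R}\{c+\frac1{1-\alpha}\mathbb E_P(Y-c)_+\}$, and $$\mathcal R_{\sigma;P}(Y):=\sup\Big\{\mathbb E_P Y\zeta:\ \zeta\ge0,\ \mathbb E_P\zeta=1,\ \mathsf{AV@R}_{\alpha;P}(\zeta)\le\tfrac1{1-\alpha}\int_\alpha^1\sigma(u)\,du\ \text{ for all }\alpha\in(0,1)\Big\}.$$ $\mathcal S_1,\dots,\mathcal S_T$ are collections of distortion functions. The conditional risk measure is $\mathcal R_{\mathcal S_{t+1}}(Y\mid x_{1:t}):=\sup_{\sigma\in\mathcal S_{t+1}}\mathcal R_{\sigma;P(\cdot\mid x_{1:t})}(Y(x_{1:t},\cdot))$, and for $s<t$ the nested risk functional is $$\mathcal R_{\mathcal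 S_{s+1:t}}(Y\mid x_{1:s}):=\mathcal R_{\mathcal S_{s+1}}\bigl(\dots\mathcal R_{\mathcal S_{t-1}}\bigl(\mathcal R_{\mathcal S_t}(Y\mid x_{1:t-1})\mid x_{1:t-2}\bigr)\dots\mid x_{1:s}\bigr);$$ $\mathcal R_{\mathcal S_{t+1:t}}$ is the identity, and $\mathcal R_{\mathcal S_{1:t}}(Y)$ is the case $s=0$. Random variables are assumed to be such that the risk functionals are well defined. Policies: $\mathcal Z_{0:T}=\mathcal Z_0\times\dots\times\mathcal Z_T$ is the set of decisions. $z_{s:t}\lhd\mathcal F_{s:t}$ means that each $z_j\colon\Xi\to\mathcal Z_j$, $s\le j\le t$, is $\mathcal F_j$-measurable, i.e. $z_j=z_j(x_{1:j})$ (adapted policy). $Q$ is lower semi-continuous; the arguments before and after the semicolon in $Q(z;x)$ are the decision and the state. Value process: for $t=0,\dots,T$, $$v_t(z_{0:t-1}\mid x_{1:t}):=\inf_{z_{t:T}\lhd\mathcal F_{t:T}}\mathcal R_{\mathcal S_{t+1:T}}\Bigl(Q\bigl(z_{0:t-1}(x_{1:t-1}),z_{t:T}(x_{1:t},\cdot);x_{1:t},\cdot\bigr)\mid x_{1:t}\Bigr).$$ Convention: infima of families of random variables (here, of functions of $x_{1:t}$ indexed by policies) are understood as essential infima, and equalities between random variables hold almost surely. *)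

theory Defs
  imports "HOL-Probability.Probability"
begin

section \<open>Polish spaces and Borel sigma algebras\<close>

text \<open>Topologies are abstract, so that the spaces of different stages may differ: any finite family
  of spaces embeds into one carrier type.\<close>

definition polish_topology :: "'a topology \<Rightarrow> bool" where
  "polish_topology X \<longleftrightarrow> completely_metrizable_space X \<and>
     (\<exists>C. countable C \<and> C \<subseteq> topspace X \<and> X closure_of C = topspace X)"

definition borel_of :: "'a topology \<Rightarrow> 'a measure" where
  "borel_of X = sigma (topspace X) {U. openin X U}"

definition lower_semicontinuous :: "'a topology \<Rightarrow> ('a \<Rightarrow> ereal) \<Rightarrow> bool" where
  "lower_semicontinuous X f \<longleftrightarrow> (\<forall>a. openin X {x \<in> topspace X. a < f x})"

lemma space_borel_of [simp]: "space (borel_of X) = topspace X"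
  unfolding borel_of_def by (rule space_measure_of) (auto dest: openin_subset)

lemma sets_borel_of: "sets (borel_of X) = sigma_sets (topspace X) {U. openin X U}"
  unfolding borel_of_def by (rule sets_measure_of) (auto dest: openin_subset)

lemma openin_in_sets_borel_of: "openin X U \<Longrightarrow> U \<in> sets (borel_of X)"
  by (auto simp: sets_borel_of)

lemma continuous_map_measurable_borel_of:
  assumes "continuous_map X Y f"
  shows "f \<in> borel_of X \<rightarrow>\<^sub>M borel_of Y"
  unfolding borel_of_def[of Y]
proof (rule measurable_measure_of)
  show "f \<in> space (borel_of X) \<rightarrow> topspace Y"
    using assms by (auto simp: continuous_map_def)
  fix U assume "U \<in> {U. openin Y U}"
  then show "f -` U \<inter> space (borel_of X) \<in> sets (borel_of X)"
    using openin_continuous_map_preimage[OF assms]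
    by (auto simp: vimage_def Int_def conj_commute intro!: openin_in_sets_borel_of)
qed (auto dest: openin_subset)

lemma polish_topology_countable_base:
  assumes "polish_topology X"
  obtains B where "countable B" "\<And>V. V \<in> B \<Longrightarrow> openin X V"
    "\<And>U x. openin X U \<Longrightarrow> x \<in> U \<Longrightarrow> \<exists>V\<in>B. x \<in> V \<and> V \<subseteq> U"
proof -
  from assms obtain M d where "Metric_space M d" and X: "X = Metric_space.mtopology M d"
    unfolding polish_topology_def completely_metrizable_space_def by blast
  then interpret Metric_space M d by simp
  from assms obtain C where C: "countable C" "C \<subseteq> M" "mtopology closure_of C = M"
    unfolding polish_topology_def X by auto
  define B where "B = (\<lambda>(c, n). mball c (inverse (real (Suc n)))) ` (C \<times> UNIV)"
  show ?thesis
  proof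
    show "countable B"
      unfolding B_def using C(1) by (intro countable_image countable_SIGMA) auto
    show "openin X V" if "V \<in> B" for V
      using that by (auto simp: B_def X)
    fix U x assume U: "openin X U" "x \<in> U"
    then obtain r where r: "r > 0" "mball x r \<subseteq> U" and x: "x \<in> M"
      unfolding X openin_mtopology by blast
    obtain n where n: "inverse (real (Suc n)) < r / 2"
      using reals_Archimedean[of "r / 2"] r by auto
    have "x \<in> mtopology closure_of C"
      using C(3) x by simp
    moreover have "inverse (real (Suc n)) > 0"
      by simp
    ultimately have "\<exists>c\<in>C. c \<in> mball x (inverse (real (Suc n)))"
      unfolding metric_closure_of by blast
    then obtain c where c: "c \<in> C" "c \<in> mball x (inverse (real (Suc n)))"
      by blast
    have "mball c (inverse (real (Suc n))) \<subseteq> mball x r"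
    proof
      fix y assume y: "y \<in> mball c (inverse (real (Suc n)))"
      then have "d x y \<le> d x c + d c y"
        using x c by (intro triangle) auto
      also have "\<dots> < r"
        using y c n by auto
      finally show "y \<in> mball x r"
        using x y by auto
    qed
    moreover have "x \<in> mball c (inverse (real (Suc n)))"
      using c x by (auto simp: commute)
    moreover have "mball c (inverse (real (Suc n))) \<in> B"
      unfolding B_def using c(1) by (intro image_eqI[of _ _ "(c, n)"]) auto
    ultimately show "\<exists>V\<in>B. x \<in> V \<and> V \<subseteq> U"
      using r(2) by blast
  qed
qed

lemma sets_borel_of_product_topology:
  assumes "finite I" and pol: "\<And>i. i \<in> I \<Longrightarrow> polish_topology (X i)"
  shows "sets (borel_of (product_topology X I)) = sets (\<Pi>\<^sub>M i\<in>I. borel_of (X i))"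
proof
  let ?P = "\<Pi>\<^sub>M i\<in>I. borel_of (X i)"
  have top: "topspace (product_topology X I) = space ?P"
    by (simp add: space_PiM)
  have "\<exists>B. countable B \<and> (\<forall>V\<in>B. openin (X i) V) \<and>
      (\<forall>U x. openin (X i) U \<longrightarrow> x \<in> U \<longrightarrow> (\<exists>V\<in>B. x \<in> V \<and> V \<subseteq> U))" if "i \<in> I" for i
    using polish_topology_countable_base[OF pol[OF that]] by metis
  then obtain B where B: "\<And>i. i \<in> I \<Longrightarrow> countable (B i)"
    "\<And>i V. i \<in> I \<Longrightarrow> V \<in> B i \<Longrightarrow> openin (X i) V"
    "\<And>i U x. i \<in> I \<Longrightarrow> openin (X i) U \<Longrightarrow> x \<in> U \<Longrightarrow> \<exists>V\<in>B i. x \<in> V \<and> V \<subseteq> U"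
    by metis
  have "W \<in> sets ?P" if W: "openin (product_topology X I) W" for W
  proof -
    define \<V> where "\<V> = {V \<in> Pi\<^sub>E I B. Pi\<^sub>E I V \<subseteq> W}"
    have "countable \<V>"
      unfolding \<V>_def using assms(1) B(1)
      by (intro countable_subset[OF _ countable_PiE[of I B]]) auto
    moreover have "Pi\<^sub>E I V \<in> sets ?P" if "V \<in> \<V>" for V
      using that assms(1) B(2) unfolding \<V>_def
      by (intro sets_PiM_I_finite) (auto intro!: openin_in_sets_borel_of)
    ultimately have "(\<Union>V\<in>\<V>. Pi\<^sub>E I V) \<in> sets ?P"
      by (intro sets.countable_UN') auto
    moreover have "W = (\<Union>V\<in>\<V>. Pi\<^sub>E I V)"
    proof (intro equalityI subsetI)
      fix x assume "x \<in> W"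
      then obtain U where U: "\<And>i. i \<in> I \<Longrightarrow> openin (X i) (U i)" "x \<in> Pi\<^sub>E I U" "Pi\<^sub>E I U \<subseteq> W"
        using W unfolding openin_product_topology_alt by meson
      have "\<exists>V\<in>B i. x i \<in> V \<and> V \<subseteq> U i" if "i \<in> I" for i
        by (rule B(3)[OF that U(1)[OF that] PiE_mem[OF U(2) that]])
      then obtain V where V: "\<And>i. i \<in> I \<Longrightarrow> V i \<in> B i \<and> x i \<in> V i \<and> V i \<subseteq> U i"
        by metis
      have "Pi\<^sub>E I (restrict V I) \<subseteq> Pi\<^sub>E I U"
        using V by (intro PiE_mono) auto
      then have "restrict V I \<in> \<V>"
        using V U(3) by (auto simp: \<V>_def)
      moreover have "x \<in> Pi\<^sub>E I (restrict V I)"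
        using V U(2) by (auto simp: PiE_iff)
      ultimately show "x \<in> (\<Union>V\<in>\<V>. Pi\<^sub>E I V)"
        by blast
    qed (auto simp: \<V>_def)
    ultimately show ?thesis by simp
  qed
  then show "sets (borel_of (product_topology X I)) \<subseteq> sets ?P"
    unfolding sets_borel_of top by (intro sets.sigma_sets_subset) auto
  have "(\<lambda>x. x) \<in> borel_of (product_topology X I) \<rightarrow>\<^sub>M ?P"
  proof (rule measurable_PiM_single')
    show "(\<lambda>x. x i) \<in> borel_of (product_topology X I) \<rightarrow>\<^sub>M borel_of (X i)" if "i \<in> I" for i
      by (intro continuous_map_measurable_borel_of continuous_map_product_projection that)
    show "(\<lambda>x i. x i) \<in> space (borel_of (product_topology X I)) \<rightarrow> (\<Pi>\<^sub>E i\<in>I. space (borel_of (X i)))"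
      by auto
  qed
  then have *: "(\<lambda>x. x) -` A \<inter> space (borel_of (product_topology X I)) \<in>
      sets (borel_of (product_topology X I))" if "A \<in> sets ?P" for A
    using that by (rule measurable_sets)
  have "A \<in> sets (borel_of (product_topology X I))" if "A \<in> sets ?P" for A
  proof -
    have "A \<inter> topspace (product_topology X I) = A"
      unfolding top using sets.sets_into_space[OF that] by (rule Int_absorb2)
    with *[OF that] show ?thesis
      by (simp del: topspace_product_topology)
  qed
  then show "sets ?P \<subseteq> sets (borel_of (product_topology X I))"
    by blast
qed


section \<open>Risk functionals\<close>

text \<open>Expectation of an extended real random variable as the difference of the expectations of its
  positive and negative parts; in \<^typ>\<open>ereal\<close>, \<open>\<infinity> - \<infinity> = \<infinity>\<close>.\<close>

definition expect :: "'m measure \<Rightarrow> ('m \<Rightarrow> ereal) \<Rightarrow> ereal" where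
  "expect M Y = enn2ereal (\<integral>\<^sup>+ \<omega>. e2ennreal (Y \<omega>) \<partial>M) - enn2ereal (\<integral>\<^sup>+ \<omega>. e2ennreal (- Y \<omega>) \<partial>M)"

definition distortion :: "(real \<Rightarrow> real) \<Rightarrow> bool" where
  "distortion \<sigma> \<longleftrightarrow> mono_on {0..<1} \<sigma> \<and> (\<forall>u\<in>{0..<1}. 0 \<le> \<sigma> u) \<and>
     (LINT u:{0..<1}|lborel. \<sigma> u) = 1"

definition AVaR :: "'m measure \<Rightarrow> real \<Rightarrow> ('m \<Rightarrow> ereal) \<Rightarrow> ereal" where
  "AVaR M \<alpha> Y =
     (INF c::real. ereal c + ereal (1 / (1 - \<alpha>)) * expect M (\<lambda>\<omega>. max 0 (Y \<omega> - ereal c)))"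

definition risk_densities :: "'m measure \<Rightarrow> (real \<Rightarrow> real) \<Rightarrow> ('m \<Rightarrow> real) set" where
  "risk_densities M \<sigma> =
     {\<zeta> \<in> borel_measurable M. (\<forall>\<omega>\<in>space M. 0 \<le> \<zeta> \<omega>) \<and> expect M (\<lambda>\<omega>. ereal (\<zeta> \<omega>)) = 1 \<and>
        (\<forall>\<alpha>\<in>{0<..<1}. AVaR M \<alpha> (\<lambda>\<omega>. ereal (\<zeta> \<omega>)) \<le>
           ereal (1 / (1 - \<alpha>) * (LINT u:{\<alpha>..<1}|lborel. \<sigma> u)))}"

definition risk :: "'m measure \<Rightarrow> (real \<Rightarrow> real) \<Rightarrow> ('m \<Rightarrow> ereal) \<Rightarrow> ereal" where
  "risk M \<sigma> Y = (SUP \<zeta>\<in>risk_densities M \<sigma>. expect M (\<lambda>\<omega>. Y \<omega> * ereal (\<zeta> \<omega>)))"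

text \<open>The risk is well defined if every expectation in the supremum is a well-defined element of
  \<open>\<real> \<union> {\<infinity>}\<close>, the range of the costs. The constant density 1 is always feasible,
  so that this includes \<open>Y > -\<infinity>\<close> almost surely.\<close>

definition risk_well_defined :: "'m measure \<Rightarrow> (real \<Rightarrow> real) \<Rightarrow> ('m \<Rightarrow> ereal) \<Rightarrow> bool" where
  "risk_well_defined M \<sigma> Y \<longleftrightarrow> Y \<in> borel_measurable M \<and>
     (\<forall>\<zeta>\<in>risk_densities M \<sigma>. (\<integral>\<^sup>+ \<omega>. e2ennreal (- (Y \<omega> * ereal (\<zeta> \<omega>))) \<partial>M) < \<infinity>)"


section \<open>Essential infima\<close>

text \<open>The family need not be countable; its essential infimum with respect to the sub-sigma-algebra
  \<open>G\<close> is the greatest \<open>G\<close>-measurable almost sure lower bound, which is unique up to null sets.\<close>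

definition is_ess_inf :: "'m measure \<Rightarrow> 'm measure \<Rightarrow> ('m \<Rightarrow> ereal) set \<Rightarrow> ('m \<Rightarrow> ereal) \<Rightarrow> bool" where
  "is_ess_inf M G A v \<longleftrightarrow> v \<in> borel_measurable G \<and> (\<forall>f\<in>A. AE \<omega> in M. v \<omega> \<le> f \<omega>) \<and>
     (\<forall>w\<in>borel_measurable G. (\<forall>f\<in>A. AE \<omega> in M. w \<omega> \<le> f \<omega>) \<longrightarrow> (AE \<omega> in M. w \<omega> \<le> v \<omega>))"

definition ess_inf :: "'m measure \<Rightarrow> 'm measure \<Rightarrow> ('m \<Rightarrow> ereal) set \<Rightarrow> ('m \<Rightarrow> ereal)" where
  "ess_inf M G A = (SOME v. is_ess_inf M G A v)"


section \<open>Multistage problems\<close>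

text \<open>A path is an extensional function on \<open>{1..T}\<close>, a decision sequence an extensional function on
  \<open>{0..T}\<close>. The field \<open>kernel p t\<close> is (a version of) the regular conditional probability given
  the first \<open>t\<close> coordinates.\<close>

record ('a, 'b) multistage =
  horizon :: nat
  state_top :: "nat \<Rightarrow> 'a topology"
  decision_top :: "nat \<Rightarrow> 'b topology"
  law :: "(nat \<Rightarrow> 'a) measure"
  kernel :: "nat \<Rightarrow> (nat \<Rightarrow> 'a) \<Rightarrow> (nat \<Rightarrow> 'a) measure"
  distortions :: "nat \<Rightarrow> (real \<Rightarrow> real) set"
  cost :: "(nat \<Rightarrow> 'b) \<Rightarrow> (nat \<Rightarrow> 'a) \<Rightarrow> ereal"

definition path_top :: "('a, 'b) multistage \<Rightarrow> nat \<Rightarrow> nat \<Rightarrow> (nat \<Rightarrow> 'a) topology" where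
  "path_top p s t = product_topology (state_top p) {s..t}"

definition decisions_top :: "('a, 'b) multistage \<Rightarrow> (nat \<Rightarrow> 'b) topology" where
  "decisions_top p = product_topology (decision_top p) {0..horizon p}"

definition history :: "nat \<Rightarrow> (nat \<Rightarrow> 'a) \<Rightarrow> (nat \<Rightarrow> 'a)" where
  "history t x = restrict x {1..t}"

definition stage_algebra :: "('a, 'b) multistage \<Rightarrow> nat \<Rightarrow> (nat \<Rightarrow> 'a) measure" where
  "stage_algebra p t =
     vimage_algebra (topspace (path_top p 1 (horizon p))) (history t) (borel_of (path_top p 1 t))"

definition regular_conditional_probability ::
  "('a, 'b) multistage \<Rightarrow> nat \<Rightarrow> ((nat \<Rightarrow> 'a) \<Rightarrow> (nat \<Rightarrow> 'a) measure) \<Rightarrow> bool" where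
  "regular_conditional_probability p t \<kappa> \<longleftrightarrow>
     \<kappa> \<in> borel_of (path_top p 1 t) \<rightarrow>\<^sub>M prob_algebra (borel_of (path_top p (Suc t) (horizon p))) \<and>
     (\<forall>A\<in>sets (borel_of (path_top p 1 t)). \<forall>B\<in>sets (borel_of (path_top p (Suc t) (horizon p))).
        emeasure (law p) {x \<in> space (law p). history t x \<in> A \<and> restrict x {Suc t..horizon p} \<in> B} =
        (\<integral>\<^sup>+ x\<in>{x. history t x \<in> A}. emeasure (\<kappa> (history t x)) B \<partial>law p))"

text \<open>A function of \<open>x\<^sub>1, \<dots>, x\<^sub>t\<close> is a function on all paths which depends only on
  the first \<open>t\<close> coordinates; \<open>section_at p t Y x\<close> is \<open>Y(x\<^sub>1, \<dots>, x\<^sub>t, \<cdot>)\<close>.\<close>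

definition section_at :: "('a, 'b) multistage \<Rightarrow> nat \<Rightarrow> ((nat \<Rightarrow> 'a) \<Rightarrow> ereal) \<Rightarrow>
    (nat \<Rightarrow> 'a) \<Rightarrow> (nat \<Rightarrow> 'a) \<Rightarrow> ereal" where
  "section_at p t Y x y = Y (merge {1..t} {Suc t..horizon p} (x, y))"

definition cond_risk :: "('a, 'b) multistage \<Rightarrow> nat \<Rightarrow> ((nat \<Rightarrow> 'a) \<Rightarrow> ereal) \<Rightarrow>
    (nat \<Rightarrow> 'a) \<Rightarrow> ereal" where
  "cond_risk p t Y x =
     (SUP \<sigma>\<in>distortions p (Suc t). risk (kernel p t (history t x)) \<sigma> (section_at p t Y x))"

text \<open>The composition of the conditional risk measures of the stages \<open>s + 1, \<dots>, t\<close>, conditional on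
  \<open>x\<^sub>1, \<dots>, x\<^sub>s\<close>; for \<open>s = 0\<close> and \<open>t > 0\<close> the result does not depend on the path at all.\<close>

definition nested_risk :: "('a, 'b) multistage \<Rightarrow> nat \<Rightarrow> nat \<Rightarrow> ((nat \<Rightarrow> 'a) \<Rightarrow> ereal) \<Rightarrow>
    (nat \<Rightarrow> 'a) \<Rightarrow> ereal" where
  "nested_risk p s t Y = foldr (cond_risk p) [s..<t] Y"

text \<open>Every risk functional which is evaluated along the composition is well defined.\<close>

definition nested_risk_well_defined ::
  "('a, 'b) multistage \<Rightarrow> nat \<Rightarrow> nat \<Rightarrow> ((nat \<Rightarrow> 'a) \<Rightarrow> ereal) \<Rightarrow> bool" where
  "nested_risk_well_defined p s t Y \<longleftrightarrow>
     (\<forall>r\<in>{s..t}. nested_risk p r t Y \<in> borel_measurable (stage_algebra p r)) \<and>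
     (\<forall>r\<in>{s..<t}. AE x in law p. \<forall>\<sigma>\<in>distortions p (Suc r).
        risk_well_defined (kernel p r (history r x)) \<sigma> (section_at p r (nested_risk p (Suc r) t Y) x))"

text \<open>Adapted policies \<open>z\<^sub>s, \<dots>, z\<^sub>t\<^sub>-\<^sub>1\<close>; the index range is half-open. The last conjunct,
  \<open>z\<^sub>j = z\<^sub>j(x\<^sub>1, \<dots>, x\<^sub>j)\<close>, follows from measurability if the decision spaces are \<open>T\<^sub>0\<close>.\<close>

definition adapted :: "('a, 'b) multistage \<Rightarrow> nat \<Rightarrow> nat \<Rightarrow> (nat \<Rightarrow> (nat \<Rightarrow> 'a) \<Rightarrow> 'b) \<Rightarrow> bool" where
  "adapted p s t z \<longleftrightarrow> (\<forall>j\<in>{s..<t}.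
     z j \<in> stage_algebra p j \<rightarrow>\<^sub>M borel_of (decision_top p j) \<and>
     (\<forall>x\<in>space (law p). \<forall>y\<in>space (law p). history j x = history j y \<longrightarrow> z j x = z j y))"

definition join_policy :: "nat \<Rightarrow> (nat \<Rightarrow> 'c) \<Rightarrow> (nat \<Rightarrow> 'c) \<Rightarrow> nat \<Rightarrow> 'c" where
  "join_policy s z z' j = (if j < s then z j else z' j)"

definition policy_cost :: "('a, 'b) multistage \<Rightarrow> (nat \<Rightarrow> (nat \<Rightarrow> 'a) \<Rightarrow> 'b) \<Rightarrow>
    (nat \<Rightarrow> 'a) \<Rightarrow> ereal" where
  "policy_cost p z x = cost p (\<lambda>j\<in>{0..horizon p}. z j x) x"

definition value_process :: "('a, 'b) multistage \<Rightarrow> nat \<Rightarrow> (nat \<Rightarrow> (nat \<Rightarrow> 'a) \<Rightarrow> 'b) \<Rightarrow>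
    (nat \<Rightarrow> 'a) \<Rightarrow> ereal" where
  "value_process p t z = ess_inf (law p) (stage_algebra p t)
     {nested_risk p t (horizon p) (policy_cost p (join_policy t z z')) | z'.
        adapted p t (Suc (horizon p)) z'}"

text \<open>The path argument is a dummy, since the unconditional nested risk does not depend on it.\<close>

definition optimal_value :: "('a, 'b) multistage \<Rightarrow> (nat \<Rightarrow> 'a) \<Rightarrow> ereal" where
  "optimal_value p x =
     (INF z\<in>{z. adapted p 0 (Suc (horizon p)) z}. nested_risk p 0 (horizon p) (policy_cost p z) x)"

definition multistage_problem :: "('a, 'b) multistage \<Rightarrow> bool" where
  "multistage_problem p \<longleftrightarrow>
     1 \<le> horizon p \<and>
     (\<forall>t\<in>{1..horizon p}. polish_topology (state_top p t)) \<and>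
     prob_space (law p) \<and> sets (law p) = sets (borel_of (path_top p 1 (horizon p))) \<and>
     (\<forall>t<horizon p. regular_conditional_probability p t (kernel p t)) \<and>
     (\<forall>t\<in>{1..horizon p}. distortions p t \<noteq> {} \<and> (\<forall>\<sigma>\<in>distortions p t. distortion \<sigma>)) \<and>
     (\<forall>z\<in>topspace (decisions_top p). \<forall>x\<in>topspace (path_top p 1 (horizon p)). cost p z x \<noteq> -\<infinity>) \<and>
     lower_semicontinuous (prod_topology (decisions_top p) (path_top p 1 (horizon p)))
       (\<lambda>(z, x). cost p z x)"

end

theory Submission
  imports Defs
begin

text \<open>
  The recursion is an exchange of infimum and risk. Write \<open>R\<^sub>s\<^sub>,\<^sub>t\<close> for the nested risk of the stages
  \<open>s + 1, \<dots>, t\<close>, so that \<open>R\<^sub>s\<^sub>,\<^sub>T = R\<^sub>s\<^sub>,\<^sub>t \<circ> R\<^sub>t\<^sub>,\<^sub>T\<close>.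

  One inequality is monotonicity. The value \<open>v\<^sub>t\<close> is an almost sure lower bound of the continuation
  risks \<open>R\<^sub>t\<^sub>,\<^sub>T(Q(z))\<close>, so that \<open>R\<^sub>s\<^sub>,\<^sub>t(v\<^sub>t) \<le> R\<^sub>s\<^sub>,\<^sub>T(Q(z))\<close>, and the essential infimum over all
  policies of the right-hand side is \<open>v\<^sub>s\<close>. Since null sets of the law are null sets of almost every
  conditional law (\<open>AE_kernel\<close>, from the disintegration \<open>law_disintegration\<close>), almost sure
  inequalities survive every conditional risk (\<open>nested_risk_le_add\<close>).

  The other inequality needs near-optimal continuations. The essential infimum of any family is an
  honest infimum over a countable subfamily (\<open>is_ess_inf_countable_INF\<close>), hence at almost every
  path some policy from a fixed sequence is \<open>\<epsilon>\<close>-optimal. The index of the first such policy is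
  measurable with respect to the first \<open>t\<close> coordinates, so that switching to it at stage \<open>t\<close> is
  again an adapted policy; and the conditional risk at a path only sees paths with the same history
  (\<open>nested_risk_cong\<close>), so that the switched policy is \<open>\<epsilon>\<close>-optimal at almost every path
  (\<open>near_optimal_continuation\<close>). Adding the constant \<open>\<epsilon>\<close> to a random variable raises every
  conditional risk by at most \<open>\<epsilon>\<close>, because the densities integrate to 1. Therefore
  \<open>v\<^sub>s \<le> R\<^sub>s\<^sub>,\<^sub>T(Q) = R\<^sub>s\<^sub>,\<^sub>t(R\<^sub>t\<^sub>,\<^sub>T(Q)) \<le> R\<^sub>s\<^sub>,\<^sub>t(v\<^sub>t) + \<epsilon>\<close>.

  Two degenerate values need care. Where \<open>v\<^sub>t = -\<infinity>\<close> there may be no \<open>\<epsilon>\<close>-optimal policy; this happens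
  on a null set only, because the constant density 1 is feasible for every distortion function
  (\<open>one_in_risk_densities\<close>) and well-defined risks exclude negative parts with infinite mean. And
  if there are no continuations at all, then \<open>v\<^sub>t = \<infinity>\<close>, a value which every conditional risk keeps,
  again because of the density 1.

  Together both inequalities say that \<open>v\<^sub>s\<close> is an essential infimum of the family
  \<open>R\<^sub>s\<^sub>,\<^sub>t(v\<^sub>t)\<close> (\<open>is_ess_inf_value_process_recursion\<close>), and essential infima are unique almost
  surely. The formula for the optimal value is the case \<open>s = 0\<close>: functions which are measurable
  with respect to the trivial stage algebra are constant, so that the essential infimum is the
  pointwise infimum.
\<close>

section \<open>Essential infima of arbitrary families\<close>

text \<open>A countable subfamily whose union has maximal measure cannot be enlarged by more than a null
  set. The supremum over countable subfamilies is attained, because the union of a maximizing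
  sequence of countable subfamilies is countable.\<close>
lemma countable_essential_cover:
  assumes "finite_measure M" and S: "S \<subseteq> sets M"
  obtains C where "countable C" "C \<subseteq> S" "\<And>B. B \<in> S \<Longrightarrow> B - \<Union>C \<in> null_sets M"
proof -
  interpret finite_measure M by fact
  define A where "A = (\<lambda>C. emeasure M (\<Union>C)) ` {C. countable C \<and> C \<subseteq> S}"
  have "emeasure M (\<Union>{}) \<in> A"
    unfolding A_def by blast
  then obtain f :: "nat \<Rightarrow> ennreal" where f: "range f \<subseteq> A" "Sup A = (SUP i. f i)"
    using ennreal_Sup_countable_SUP[of A] by blast
  have "\<forall>n. \<exists>C. countable C \<and> C \<subseteq> S \<and> f n = emeasure M (\<Union>C)"
    using f(1) unfolding A_def by blast
  then obtain C where C: "\<And>n. countable (C n)" "\<And>n. C n \<subseteq> S" "\<And>n. f n = emeasure M (\<Union>(C n))"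
    by metis
  define D where "D = (\<Union>n. C n)"
  have D: "countable D" "D \<subseteq> S"
    using C unfolding D_def by auto
  have D_sets: "\<Union>D \<in> sets M"
    using D S by (intro sets.countable_Union) auto
  have "f n \<le> emeasure M (\<Union>D)" for n
    unfolding C(3) using D_sets by (intro emeasure_mono) (auto simp: D_def)
  then have max: "Sup A \<le> emeasure M (\<Union>D)"
    unfolding f(2) by (intro SUP_least)
  have "B - \<Union>D \<in> null_sets M" if B: "B \<in> S" for B
  proof -
    have B_sets: "B - \<Union>D \<in> sets M"
      using B S D_sets by auto
    have "emeasure M (\<Union>D) + emeasure M (B - \<Union>D) = emeasure M (\<Union>(insert B D))"
      using D_sets B_sets by (subst plus_emeasure) (auto intro!: arg_cong[of _ _ "emeasure M"])
    also have "\<dots> \<le> Sup A"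
      using B D unfolding A_def by (intro Sup_upper imageI) auto
    also note max
    finally have "emeasure M (\<Union>D) + emeasure M (B - \<Union>D) \<le> emeasure M (\<Union>D) + 0"
      by simp
    then have "emeasure M (B - \<Union>D) = 0"
      using emeasure_finite[of "\<Union>D"] by (subst (asm) ennreal_add_left_cancel_le) auto
    with B_sets show ?thesis by auto
  qed
  with D show thesis by (rule that)
qed

text \<open>For each rational \<open>q\<close> choose countably many members whose sublevel sets at \<open>q\<close> essentially
  cover the sublevel sets at \<open>q\<close> of all members. The infimum over the countable union of these
  choices is measurable, and no member can be smaller on a set of positive measure, because a strict
  inequality between two extended reals is witnessed by a rational in between. In particular
  essential infima exist.\<close>
lemma is_ess_inf_countable_INF:
  assumes "finite_measure M" and G: "space G = space M" "sets G \<subseteq> sets M"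
    and A: "A \<subseteq> borel_measurable G"
  obtains C where "countable C" "C \<subseteq> A" "is_ess_inf M G A (\<lambda>x. INF f\<in>C. f x)"
proof -
  define L where "L q f = {x \<in> space M. f x < ereal (real_of_rat q)}" for q and f :: "_ \<Rightarrow> ereal"
  have L_sets: "L q f \<in> sets M" if "f \<in> A" for q f
  proof -
    have "{x \<in> space G. f x < ereal (real_of_rat q)} \<in> sets G"
      using that A by (auto intro!: borel_measurable_less)
    then show ?thesis
      using G by (auto simp: L_def)
  qed
  have "\<exists>C. countable C \<and> C \<subseteq> A \<and> (\<forall>f\<in>A. L q f - (\<Union>g\<in>C. L q g) \<in> null_sets M)" for q
  proof -
    have "L q ` A \<subseteq> sets M"
      using L_sets by auto
    then obtain C where
      C: "countable C" "C \<subseteq> L q ` A" "\<And>B. B \<in> L q ` A \<Longrightarrow> B - \<Union>C \<in> null_sets M"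
      by (rule countable_essential_cover[OF assms(1)]) (rule that)
    have "\<exists>C'. countable C' \<and> C' \<subseteq> A \<and> C = L q ` C'"
      using C(1,2) countable_subset_image[of C "L q" A] by simp
    then obtain C' where "countable C'" "C' \<subseteq> A" "C = L q ` C'"
      by (elim exE conjE)
    with C(3) show ?thesis by blast
  qed
  then obtain C where C: "\<And>q. countable (C q)" "\<And>q. C q \<subseteq> A"
    "\<And>q f. f \<in> A \<Longrightarrow> L q f - (\<Union>g\<in>C q. L q g) \<in> null_sets M"
    by metis
  define D where "D = (\<Union>q. C q)"
  have D: "countable D" "D \<subseteq> A"
    using C by (auto simp: D_def)
  have "AE x in M. (INF g\<in>D. g x) \<le> f x" if "f \<in> A" for f
  proof -
    have "AE x in M. \<forall>q. x \<notin> L q f - (\<Union>g\<in>C q. L q g)"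
      unfolding AE_all_countable using C(3)[OF that] by (blast intro: AE_not_in)
    with AE_space show ?thesis
    proof eventually_elim
      case (elim x)
      show ?case
      proof (rule ccontr)
        assume "\<not> (INF g\<in>D. g x) \<le> f x"
        then obtain q where q: "f x < real_of_rat q" "real_of_rat q < (INF g\<in>D. g x)"
          using ereal_dense3 by (meson not_le)
        with elim obtain g where "g \<in> C q" "g x < real_of_rat q"
          by (auto simp: L_def)
        then have "(INF g\<in>D. g x) < real_of_rat q"
          by (intro INF_less_iff[THEN iffD2]) (auto simp: D_def)
        with q show False by simp
      qed
    qed
  qed
  moreover have "AE x in M. w x \<le> (INF g\<in>D. g x)" if "\<forall>f\<in>A. AE x in M. w x \<le> f x" for w
  proof -
    have "AE x in M. \<forall>g\<in>D. w x \<le> g x"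
      using that D by (auto simp: AE_ball_countable)
    then show ?thesis
      by eventually_elim (auto intro: INF_greatest)
  qed
  moreover have "(\<lambda>x. INF g\<in>D. g x) \<in> borel_measurable G"
    using D A by (intro borel_measurable_INF) auto
  ultimately show thesis
    using D by (intro that[of D]) (auto simp: is_ess_inf_def)
qed

lemma is_ess_inf_measurable: "is_ess_inf M G A v \<Longrightarrow> v \<in> borel_measurable G"
  by (simp add: is_ess_inf_def)

lemma is_ess_inf_lower: "is_ess_inf M G A v \<Longrightarrow> f \<in> A \<Longrightarrow> AE x in M. v x \<le> f x"
  by (simp add: is_ess_inf_def)

lemma is_ess_inf_greatest:
  assumes "is_ess_inf M G A v" "w \<in> borel_measurable G" "\<And>f. f \<in> A \<Longrightarrow> AE x in M. w x \<le> f x"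
  shows "AE x in M. w x \<le> v x"
  using assms by (simp add: is_ess_inf_def)

lemma is_ess_inf_unique:
  assumes "is_ess_inf M G A v" "is_ess_inf M G A w"
  shows "AE x in M. v x = w x"
proof -
  have "AE x in M. v x \<le> w x" "AE x in M. w x \<le> v x"
    using assms unfolding is_ess_inf_def by auto
  then show ?thesis
    by eventually_elim simp
qed

lemma is_ess_inf_ess_inf:
  assumes "is_ess_inf M G A v"
  shows "is_ess_inf M G A (ess_inf M G A)"
  unfolding ess_inf_def using assms by (rule someI[of "is_ess_inf M G A"])

text \<open>An almost sure inequality between constant functions holds everywhere.\<close>
lemma is_ess_inf_trivial_algebra:
  assumes "prob_space M" and "space G = space M"
    and const: "\<And>f x y. (f :: _ \<Rightarrow> ereal) \<in> borel_measurable G \<Longrightarrow> x \<in> space M \<Longrightarrow> y \<in> space M \<Longrightarrow> f x = f y"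
    and A: "A \<subseteq> borel_measurable G" and v: "is_ess_inf M G A v" and x: "x \<in> space M"
  shows "v x = (INF f\<in>A. f x)"
proof -
  interpret prob_space M by fact
  have everywhere: "f x \<le> g x"
    if "AE y in M. f y \<le> g y" "f \<in> borel_measurable G" "g \<in> borel_measurable G" for f g :: "_ \<Rightarrow> ereal"
  proof -
    have "AE y in M. f x \<le> g x"
      using that(1) AE_space
      by eventually_elim (metis const[OF that(2) x] const[OF that(3) x])
    then show ?thesis by simp
  qed
  have "AE y in M. (INF f\<in>A. f x) \<le> f y" if "f \<in> A" for f
    using AE_space
  proof eventually_elim
    case (elim y)
    then have "f x = f y"
      using const[of f x y] A that x by auto
    then show ?case
      using INF_lower[OF that, of "\<lambda>f. f x"] by simp
  qed
  moreover have "(\<lambda>y. INF f\<in>A. f x) \<in> borel_measurable G"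
    by simp
  ultimately have "AE y in M. (INF f\<in>A. f x) \<le> v y"
    by (intro is_ess_inf_greatest[OF v])
  then have "(INF f\<in>A. f x) \<le> v x"
    by (rule everywhere) (simp_all add: is_ess_inf_measurable[OF v])
  moreover have "v x \<le> f x" if "f \<in> A" for f
    by (rule everywhere[OF is_ess_inf_lower[OF v that]]) (use is_ess_inf_measurable[OF v] A that in auto)
  ultimately show ?thesis
    by (intro antisym INF_greatest)
qed

section \<open>Risk functionals\<close>

text \<open>The convention \<open>\<infinity> - \<infinity> = \<infinity>\<close> makes \<^const>\<open>expect\<close> monotone on all functions, integrable
  and measurable or not: the subtraction of extended reals is monotone in the first and antitone in
  the second argument without exception.\<close>
lemma expect_mono_AE:
  assumes "AE \<omega> in M. X \<omega> \<le> Y \<omega>"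
  shows "expect M X \<le> expect M Y"
proof -
  have "(\<integral>\<^sup>+ \<omega>. e2ennreal (X \<omega>) \<partial>M) \<le> (\<integral>\<^sup>+ \<omega>. e2ennreal (Y \<omega>) \<partial>M)"
    using assms by (intro nn_integral_mono_AE) (auto elim!: eventually_mono intro: e2ennreal_mono)
  moreover have "(\<integral>\<^sup>+ \<omega>. e2ennreal (- Y \<omega>) \<partial>M) \<le> (\<integral>\<^sup>+ \<omega>. e2ennreal (- X \<omega>) \<partial>M)"
    using assms by (intro nn_integral_mono_AE) (auto elim!: eventually_mono intro: e2ennreal_mono)
  ultimately show ?thesis
    unfolding expect_def by (intro ereal_minus_mono) (auto simp: less_eq_ennreal.rep_eq)
qed

lemma nn_integral_risk_density:
  assumes "\<zeta> \<in> risk_densities M \<sigma>"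
  shows "(\<integral>\<^sup>+ \<omega>. ennreal (\<zeta> \<omega>) \<partial>M) = 1"
proof -
  have "(\<integral>\<^sup>+ \<omega>. e2ennreal (- ereal (\<zeta> \<omega>)) \<partial>M) = (\<integral>\<^sup>+ \<omega>. 0 \<partial>M)"
    using assms unfolding risk_densities_def
    by (intro nn_integral_cong e2ennreal_neg) auto
  moreover have "expect M (\<lambda>\<omega>. ereal (\<zeta> \<omega>)) = 1"
    using assms by (simp add: risk_densities_def)
  ultimately have "enn2ereal (\<integral>\<^sup>+ \<omega>. ennreal (\<zeta> \<omega>) \<partial>M) = enn2ereal 1"
    by (simp add: expect_def zero_ennreal.rep_eq one_ennreal.rep_eq)
  then show ?thesis
    by (simp only: enn2ereal_inject)
qed

text \<open>Additivity of the expectation, in the form of an inequality for a nonnegative integrable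
  summand. The pointwise identity \<open>(X + b)\<^sup>+ + X\<^sup>- = X\<^sup>+ + b + (X + b)\<^sup>-\<close> contains no difference and so
  holds for infinite values as well. It is integrated first; the finite integrals of the negative
  parts are subtracted afterwards.\<close>
lemma expect_add_density_le:
  fixes X :: "'m \<Rightarrow> ereal"
  assumes X: "X \<in> borel_measurable M" "(\<integral>\<^sup>+ \<omega>. e2ennreal (- X \<omega>) \<partial>M) < \<infinity>"
    and b: "b \<in> borel_measurable M" "\<And>\<omega>. \<omega> \<in> space M \<Longrightarrow> 0 \<le> b \<omega>"
    and \<epsilon>: "(\<integral>\<^sup>+ \<omega>. ennreal (b \<omega>) \<partial>M) = ennreal \<epsilon>" "0 \<le> \<epsilon>"
  shows "expect M (\<lambda>\<omega>. X \<omega> + ereal (b \<omega>)) \<le> expect M X + ereal \<epsilon>"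
proof -
  note X(1)[measurable] b(1)[measurable]
  let ?Z = "\<lambda>\<omega>. X \<omega> + ereal (b \<omega>)"
  let ?p = "\<lambda>X. \<integral>\<^sup>+ \<omega>. e2ennreal (X \<omega>) \<partial>M" and ?n = "\<lambda>X. \<integral>\<^sup>+ \<omega>. e2ennreal (- X \<omega>) \<partial>M"
  have pointwise: "e2ennreal (x + ereal c) + e2ennreal (- x) =
      e2ennreal x + ennreal c + e2ennreal (- (x + ereal c))" if "0 \<le> c" for x c
  proof (cases x)
    case (real r)
    have "ennreal (r + c) + ennreal (- r) = ennreal r + ennreal c + ennreal (- (r + c))"
    proof (cases "0 \<le> r")
      case True
      then show ?thesis using that by (simp add: ennreal_neg flip: ennreal_plus)
    next
      case False
      then show ?thesis using that
        by (cases "0 \<le> r + c") (simp_all add: ennreal_neg flip: ennreal_plus)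
    qed
    then show ?thesis using real by simp
  qed (auto simp: e2ennreal_neg top_ennreal_def[symmetric] e2ennreal_infty)
  have "(\<integral>\<^sup>+ \<omega>. e2ennreal (?Z \<omega>) + e2ennreal (- X \<omega>) \<partial>M) =
      (\<integral>\<^sup>+ \<omega>. e2ennreal (X \<omega>) + ennreal (b \<omega>) + e2ennreal (- ?Z \<omega>) \<partial>M)"
    by (intro nn_integral_cong pointwise b(2))
  then have eq: "?p ?Z + ?n X = ?p X + ennreal \<epsilon> + ?n ?Z"
    by (simp add: nn_integral_add \<epsilon>(1))
  have "?n ?Z \<le> ?n X"
    using b(2) by (intro nn_integral_mono e2ennreal_mono) (simp add: ereal_le_add_self)
  then have fin: "?n ?Z < \<infinity>"
    using X(2) by (rule le_less_trans)
  obtain c d where cd: "?n X = ennreal c" "0 \<le> c" "?n ?Z = ennreal d" "0 \<le> d"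
    using X(2) fin by (cases "?n X"; cases "?n ?Z") auto
  show ?thesis
  proof (cases "?p X")
    case (real a)
    then have "?p ?Z \<noteq> \<infinity>"
      using eq cd \<epsilon>(2) by (auto simp flip: ennreal_plus)
    then obtain e where e: "?p ?Z = ennreal e" "0 \<le> e"
      by (cases "?p ?Z") auto
    then have "e + c = a + \<epsilon> + d"
      using eq real cd \<epsilon>(2) by (simp flip: ennreal_plus)
    then show ?thesis
      using e real cd by (simp add: expect_def enn2ereal_ennreal)
  next
    case top
    then show ?thesis
      using cd by (simp add: expect_def enn2ereal_ennreal)
  qed
qed

lemma risk_mono_AE:
  assumes "AE \<omega> in M. X \<omega> \<le> Y \<omega>"
  shows "risk M \<sigma> X \<le> risk M \<sigma> Y"
  unfolding risk_def
proof (intro SUP_mono bexI)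
  fix \<zeta> assume \<zeta>: "\<zeta> \<in> risk_densities M \<sigma>"
  have "AE \<omega> in M. X \<omega> * ereal (\<zeta> \<omega>) \<le> Y \<omega> * ereal (\<zeta> \<omega>)"
    using assms AE_space
    by eventually_elim (use \<zeta> in \<open>auto simp: risk_densities_def intro!: ereal_mult_right_mono\<close>)
  then show "expect M (\<lambda>\<omega>. X \<omega> * ereal (\<zeta> \<omega>)) \<le> expect M (\<lambda>\<omega>. Y \<omega> * ereal (\<zeta> \<omega>))"
    by (rule expect_mono_AE)
qed

lemma risk_cong:
  assumes "\<And>\<omega>. \<omega> \<in> space M \<Longrightarrow> X \<omega> = Y \<omega>"
  shows "risk M \<sigma> X = risk M \<sigma> Y"
  using assms by (intro antisym risk_mono_AE AE_I2) auto

text \<open>Translation: \<open>E (Y + \<epsilon>) \<zeta> \<le> E Y \<zeta> + \<epsilon>\<close> for every density \<open>\<zeta>\<close>, since \<open>E \<zeta> = 1\<close>. Well-definedness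
  makes the negative part of \<open>Y \<zeta>\<close> integrable, so that it can be subtracted.\<close>
lemma risk_add_const_le:
  assumes Y: "risk_well_defined M \<sigma> Y" and \<epsilon>: "0 \<le> \<epsilon>"
  shows "risk M \<sigma> (\<lambda>\<omega>. Y \<omega> + ereal \<epsilon>) \<le> risk M \<sigma> Y + ereal \<epsilon>"
  unfolding risk_def
proof (rule SUP_least)
  fix \<zeta> assume \<zeta>: "\<zeta> \<in> risk_densities M \<sigma>"
  then have nonneg: "0 \<le> \<zeta> \<omega>" if "\<omega> \<in> space M" for \<omega>
    using that by (auto simp: risk_densities_def)
  have [measurable]: "\<zeta> \<in> borel_measurable M" "Y \<in> borel_measurable M"
    using \<zeta> Y by (auto simp: risk_densities_def risk_well_defined_def)
  have "expect M (\<lambda>\<omega>. (Y \<omega> + ereal \<epsilon>) * ereal (\<zeta> \<omega>)) \<le>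
      expect M (\<lambda>\<omega>. Y \<omega> * ereal (\<zeta> \<omega>) + ereal (\<epsilon> * \<zeta> \<omega>))"
  proof (intro expect_mono_AE AE_I2)
    fix \<omega> assume "\<omega> \<in> space M"
    then show "(Y \<omega> + ereal \<epsilon>) * ereal (\<zeta> \<omega>) \<le> Y \<omega> * ereal (\<zeta> \<omega>) + ereal (\<epsilon> * \<zeta> \<omega>)"
      using nonneg[of \<omega>] \<epsilon> by (cases "Y \<omega>") (auto simp: algebra_simps)
  qed
  also have "\<dots> \<le> expect M (\<lambda>\<omega>. Y \<omega> * ereal (\<zeta> \<omega>)) + ereal \<epsilon>"
  proof (rule expect_add_density_le)
    show "(\<integral>\<^sup>+ \<omega>. e2ennreal (- (Y \<omega> * ereal (\<zeta> \<omega>))) \<partial>M) < \<infinity>"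
      using Y \<zeta> by (auto simp: risk_well_defined_def)
    show "(\<integral>\<^sup>+ \<omega>. ennreal (\<epsilon> * \<zeta> \<omega>) \<partial>M) = ennreal \<epsilon>"
    proof -
      have "(\<integral>\<^sup>+ \<omega>. ennreal (\<epsilon> * \<zeta> \<omega>) \<partial>M) = (\<integral>\<^sup>+ \<omega>. ennreal \<epsilon> * ennreal (\<zeta> \<omega>) \<partial>M)"
        using \<epsilon> nonneg by (intro nn_integral_cong) (simp add: ennreal_mult)
      then show ?thesis
        by (simp add: nn_integral_cmult nn_integral_risk_density[OF \<zeta>])
    qed
  qed (use \<epsilon> nonneg in auto)
  also have "\<dots> \<le> (SUP \<zeta>\<in>risk_densities M \<sigma>. expect M (\<lambda>\<omega>. Y \<omega> * ereal (\<zeta> \<omega>))) + ereal \<epsilon>"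
    using \<zeta> by (intro add_right_mono SUP_upper)
  finally show "expect M (\<lambda>\<omega>. (Y \<omega> + ereal \<epsilon>) * ereal (\<zeta> \<omega>)) \<le>
    (SUP \<zeta>\<in>risk_densities M \<sigma>. expect M (\<lambda>\<omega>. Y \<omega> * ereal (\<zeta> \<omega>))) + ereal \<epsilon>" .
qed

text \<open>A nondecreasing function has its largest values on the tail, so that its mean over the tail is
  at least its mean 1 over the unit interval. The comparison is with the constant \<open>\<sigma> \<alpha>\<close>: if
  \<open>\<sigma> \<alpha> \<le> 1\<close>, then at most the mass \<open>\<alpha>\<close> lies below \<open>\<alpha>\<close>, and otherwise the tail has mass at least
  \<open>(1 - \<alpha>) \<sigma> \<alpha>\<close>.\<close>
lemma distortion_tail_integral_ge:
  assumes \<sigma>: "distortion \<sigma>" and \<alpha>: "\<alpha> \<in> {0<..<1}"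
  shows "1 - \<alpha> \<le> (LINT u:{\<alpha>..<1}|lborel. \<sigma> u)"
proof -
  have mono: "mono_on {0..<1} \<sigma>" and total: "(LINT u:{0..<1}|lborel. \<sigma> u) = 1"
    using \<sigma> by (auto simp: distortion_def)
  \<comment> \<open>The integral of a function that is not integrable would be 0.\<close>
  have int: "set_integrable lborel {0..<1} \<sigma>"
    using total not_integrable_integral_eq[of lborel "\<lambda>u. indicator {0..<1} u *\<^sub>R \<sigma> u"]
    unfolding set_integrable_def set_lebesgue_integral_def by auto
  have int1: "set_integrable lborel {0..<\<alpha>} \<sigma>" and int2: "set_integrable lborel {\<alpha>..<1} \<sigma>"
    using \<alpha> by (auto intro!: set_integrable_subset[OF int])
  have const: "set_integrable lborel {a..<b} (\<lambda>_. \<sigma> \<alpha>)" "(LINT u:{a..<b}|lborel. \<sigma> \<alpha>) = (b - a) * \<sigma> \<alpha>"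
    if "a \<le> b" for a b :: real
    using that by (auto simp: set_integrable_def set_lebesgue_integral_def)
  have "{0..<1} = {0..<\<alpha>} \<union> {\<alpha>..<1}"
    using \<alpha> by auto
  then have split: "1 = (LINT u:{0..<\<alpha>}|lborel. \<sigma> u) + (LINT u:{\<alpha>..<1}|lborel. \<sigma> u)"
    using set_integral_Un[OF _ int1 int2] total by auto
  have "(LINT u:{0..<\<alpha>}|lborel. \<sigma> u) \<le> (LINT u:{0..<\<alpha>}|lborel. \<sigma> \<alpha>)"
    using \<alpha> by (intro set_integral_mono int1 const mono_onD[OF mono]) auto
  then have below: "(LINT u:{0..<\<alpha>}|lborel. \<sigma> u) \<le> \<alpha> * \<sigma> \<alpha>"
    using const(2)[of 0 \<alpha>] \<alpha> by simp
  have "(LINT u:{\<alpha>..<1}|lborel. \<sigma> \<alpha>) \<le> (LINT u:{\<alpha>..<1}|lborel. \<sigma> u)"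
    using \<alpha> by (intro set_integral_mono int2 const mono_onD[OF mono]) auto
  then have above: "(1 - \<alpha>) * \<sigma> \<alpha> \<le> (LINT u:{\<alpha>..<1}|lborel. \<sigma> u)"
    using const(2)[of \<alpha> 1] \<alpha> by simp
  show ?thesis
  proof (cases "\<sigma> \<alpha> \<le> 1")
    case True
    then have "\<alpha> * \<sigma> \<alpha> \<le> \<alpha> * 1"
      using \<alpha> by (intro mult_left_mono) auto
    then show ?thesis
      using split below by simp
  next
    case False
    then have "(1 - \<alpha>) * 1 \<le> (1 - \<alpha>) * \<sigma> \<alpha>"
      using \<alpha> by (intro mult_left_mono) auto
    then show ?thesis
      using above by simp
  qed
qed

text \<open>The constant 1 has average value at risk at most 1, as \<open>c = 1\<close> in the infimum shows, which
  the average of \<open>\<sigma>\<close> over the tail dominates.\<close>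
lemma one_in_risk_densities:
  assumes "prob_space M" and "distortion \<sigma>"
  shows "(\<lambda>_. 1) \<in> risk_densities M \<sigma>"
proof -
  interpret prob_space M by fact
  have "AVaR M \<alpha> (\<lambda>_. ereal 1) \<le> ereal (1 / (1 - \<alpha>) * (LINT u:{\<alpha>..<1}|lborel. \<sigma> u))"
    if \<alpha>: "\<alpha> \<in> {0<..<1}" for \<alpha>
  proof -
    have "AVaR M \<alpha> (\<lambda>_. ereal 1) \<le>
        ereal 1 + ereal (1 / (1 - \<alpha>)) * expect M (\<lambda>\<omega>. max 0 (ereal 1 - ereal 1))"
      unfolding AVaR_def by (rule INF_lower) simp
    also have "\<dots> = ereal 1"
      by (simp add: expect_def zero_ennreal.rep_eq)
    also have "1 \<le> 1 / (1 - \<alpha>) * (LINT u:{\<alpha>..<1}|lborel. \<sigma> u)"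
      using distortion_tail_integral_ge[OF assms(2) \<alpha>] \<alpha> by (simp add: field_simps)
    finally show ?thesis by simp
  qed
  moreover have "expect M (\<lambda>_. ereal 1) = 1"
    by (simp add: expect_def emeasure_space_1 ennreal_neg zero_ennreal.rep_eq one_ennreal.rep_eq)
  ultimately show ?thesis
    by (simp add: risk_densities_def)
qed

text \<open>The expectation with respect to the density 1 is already infinite. Without a feasible density
  the risk would be the supremum of the empty set, \<open>-\<infinity>\<close>.\<close>
lemma risk_top:
  assumes "prob_space M" and "distortion \<sigma>" and "AE \<omega> in M. X \<omega> = \<infinity>"
  shows "risk M \<sigma> X = \<infinity>"
proof -
  interpret prob_space M by fact
  have "(\<integral>\<^sup>+ \<omega>. e2ennreal (- (X \<omega> * ereal 1)) \<partial>M) = (\<integral>\<^sup>+ \<omega>. 0 \<partial>M)"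
    using assms(3) by (intro nn_integral_cong_AE) (auto elim!: eventually_mono simp: e2ennreal_neg)
  moreover have "(\<integral>\<^sup>+ \<omega>. e2ennreal (X \<omega> * ereal 1) \<partial>M) = (\<integral>\<^sup>+ \<omega>. \<infinity> \<partial>M)"
    using assms(3) by (intro nn_integral_cong_AE) (auto elim!: eventually_mono)
  ultimately have "expect M (\<lambda>\<omega>. X \<omega> * ereal 1) = \<infinity>"
    by (simp add: expect_def emeasure_space_1 ennreal_top_mult zero_ennreal.rep_eq)
  moreover have "expect M (\<lambda>\<omega>. X \<omega> * ereal 1) \<le> risk M \<sigma> X"
    unfolding risk_def using one_in_risk_densities[OF assms(1,2)] by (rule SUP_upper)
  ultimately show ?thesis
    by simp
qed

lemma risk_well_defined_AE_not_MInfty: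
  assumes "prob_space M" and "distortion \<sigma>" and Y: "risk_well_defined M \<sigma> Y"
  shows "AE \<omega> in M. Y \<omega> \<noteq> -\<infinity>"
proof -
  have [measurable]: "Y \<in> borel_measurable M"
    using Y by (simp add: risk_well_defined_def)
  have "(\<integral>\<^sup>+ \<omega>. e2ennreal (- (Y \<omega> * ereal 1)) \<partial>M) < \<infinity>"
    using Y one_in_risk_densities[OF assms(1,2)] by (auto simp: risk_well_defined_def)
  then have "(\<integral>\<^sup>+ \<omega>. e2ennreal (- Y \<omega>) \<partial>M) \<noteq> \<infinity>"
    by simp
  then have "AE \<omega> in M. e2ennreal (- Y \<omega>) \<noteq> \<infinity>"
    by (intro nn_integral_PInf_AE) auto
  then show ?thesis
    by eventually_elim auto
qed

section \<open>Stage algebras and disintegration of the law\<close>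
locale multistage_program =
  fixes p :: "('a, 'b) multistage"
  assumes problem: "multistage_problem p"
begin

abbreviation "T \<equiv> horizon p"

lemma prob_space_law: "prob_space (law p)"
  using problem by (simp add: multistage_problem_def)

sublocale law: prob_space "law p"
  by (rule prob_space_law)

lemma distortions_stage:
  assumes "t < T"
  shows "distortions p (Suc t) \<noteq> {}" "\<And>\<sigma>. \<sigma> \<in> distortions p (Suc t) \<Longrightarrow> distortion \<sigma>"
proof -
  have "Suc t \<in> {1..T}"
    using assms by simp
  then show "distortions p (Suc t) \<noteq> {}" "\<And>\<sigma>. \<sigma> \<in> distortions p (Suc t) \<Longrightarrow> distortion \<sigma>"
    using problem unfolding multistage_problem_def by blast+
qed

lemma sets_path_space:
  assumes "1 \<le> a" "b \<le> T"
  shows "sets (borel_of (path_top p a b)) = sets (\<Pi>\<^sub>M i\<in>{a..b}. borel_of (state_top p i))"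
  unfolding path_top_def using problem assms
  by (intro sets_borel_of_product_topology) (auto simp: multistage_problem_def)

lemma sets_law: "sets (law p) = sets (borel_of (path_top p 1 T))"
  using problem by (simp add: multistage_problem_def)

lemma space_law: "space (law p) = topspace (path_top p 1 T)"
  using sets_eq_imp_space_eq[OF sets_law] by simp

lemma history_history: "s \<le> t \<Longrightarrow> history s (history t x) = history s x"
  by (auto simp: history_def fun_eq_iff restrict_def)

lemma history_measurable:
  assumes "s \<le> t" "t \<le> T"
  shows "history s \<in> borel_of (path_top p 1 t) \<rightarrow>\<^sub>M borel_of (path_top p 1 s)"
proof -
  have "history s \<in> (\<Pi>\<^sub>M i\<in>{1..t}. borel_of (state_top p i)) \<rightarrow>\<^sub>M (\<Pi>\<^sub>M i\<in>{1..s}. borel_of (state_top p i))"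
    unfolding history_def using assms by (intro measurable_restrict_subset) auto
  then show ?thesis
    using assms by (simp cong: measurable_cong_sets add: sets_path_space)
qed

lemma history_measurable_law:
  assumes "t \<le> T"
  shows "history t \<in> law p \<rightarrow>\<^sub>M borel_of (path_top p 1 t)"
  using history_measurable[OF assms order_refl] by (simp cong: measurable_cong_sets add: sets_law)

lemma space_stage_algebra: "space (stage_algebra p t) = space (law p)"
  by (simp add: stage_algebra_def space_law)

lemma sets_stage_algebra:
  assumes "t \<le> T"
  shows "sets (stage_algebra p t) =
    {history t -` A \<inter> space (law p) | A. A \<in> sets (borel_of (path_top p 1 t))}"
  unfolding stage_algebra_def space_law[symmetric]
  using measurable_space[OF history_measurable_law[OF assms]] by (intro sets_vimage_algebra2) auto

lemma sets_stage_algebra_subset_law: "t \<le> T \<Longrightarrow> sets (stage_algebra p t) \<subseteq> sets (law p)"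
  using measurable_sets[OF history_measurable_law] by (auto simp: sets_stage_algebra)

lemma sets_stage_algebra_mono:
  assumes "s \<le> t" "t \<le> T"
  shows "sets (stage_algebra p s) \<subseteq> sets (stage_algebra p t)"
proof
  fix B assume "B \<in> sets (stage_algebra p s)"
  then obtain A where A: "A \<in> sets (borel_of (path_top p 1 s))" "B = history s -` A \<inter> space (law p)"
    using assms by (auto simp: sets_stage_algebra)
  let ?A = "history s -` A \<inter> space (borel_of (path_top p 1 t))"
  have "?A \<in> sets (borel_of (path_top p 1 t))"
    using history_measurable[OF assms] A(1) by (rule measurable_sets)
  moreover have "B = history t -` ?A \<inter> space (law p)"
    using A(2) measurable_space[OF history_measurable_law[OF assms(2)]] assms(1)
    by (auto simp: history_history)
  ultimately show "B \<in> sets (stage_algebra p t)"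
    unfolding sets_stage_algebra[OF assms(2)] by blast
qed

lemma measurable_stage_algebra_mono:
  assumes "f \<in> stage_algebra p s \<rightarrow>\<^sub>M N" "s \<le> t" "t \<le> T"
  shows "f \<in> stage_algebra p t \<rightarrow>\<^sub>M N"
  using assms measurable_mono[OF order_refl refl sets_stage_algebra_mono[OF assms(2,3)], of N]
  by (auto simp: space_stage_algebra)

text \<open>The members of a stage algebra are preimages under \<^term>\<open>history t\<close> and do not separate
  paths with the same history. The level set of \<open>f\<close> through \<open>x\<close> is such a member.\<close>
lemma stage_measurable_history:
  assumes f: "f \<in> stage_algebra p t \<rightarrow>\<^sub>M N" "t \<le> T" and N: "{f x} \<in> sets N"
    and x: "x \<in> space (law p)" and y: "y \<in> space (law p)" "history t x = history t y"
  shows "f y = f x"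
proof -
  have "f -` {f x} \<inter> space (law p) \<in> sets (stage_algebra p t)"
    using measurable_sets[OF f(1) N] by (simp add: space_stage_algebra)
  then obtain A where "f -` {f x} \<inter> space (law p) = history t -` A \<inter> space (law p)"
    using f(2) by (auto simp: sets_stage_algebra)
  then show ?thesis
    using x y by (metis (mono_tags) IntD1 IntI insertI1 singletonD vimageD vimageI)
qed

lemma stage_algebra_0_const:
  fixes f :: "(nat \<Rightarrow> 'a) \<Rightarrow> ereal"
  assumes "f \<in> borel_measurable (stage_algebra p 0)" "x \<in> space (law p)" "y \<in> space (law p)"
  shows "f x = f y"
proof -
  have "history 0 y = history 0 x"
    by (simp add: history_def restrict_def)
  with assms show ?thesis
    by (intro stage_measurable_history[of f 0 borel y x]) auto
qed

abbreviation glue :: "nat \<Rightarrow> (nat \<Rightarrow> 'a) \<Rightarrow> (nat \<Rightarrow> 'a) \<Rightarrow> nat \<Rightarrow> 'a" where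
  "glue t x y \<equiv> merge {1..t} {Suc t..T} (x, y)"

lemma history_glue: "s \<le> t \<Longrightarrow> history s (glue t x y) = history s x"
  by (auto simp: history_def merge_def fun_eq_iff)

lemma glue_history: "glue t (history t x) y = glue t x y"
  by (auto simp: history_def merge_def fun_eq_iff)

lemma glue_in_space:
  assumes "x \<in> space (law p)" "y \<in> topspace (path_top p (Suc t) T)" "t \<le> T"
  shows "glue t x y \<in> space (law p)"
  using assms unfolding space_law path_top_def by (auto simp: merge_def PiE_iff extensional_def)

lemma kernel_measurable:
  assumes "t < T"
  shows "(\<lambda>x. kernel p t (history t x)) \<in> law p \<rightarrow>\<^sub>M prob_algebra (borel_of (path_top p (Suc t) T))"
proof -
  have "kernel p t \<in> borel_of (path_top p 1 t) \<rightarrow>\<^sub>M prob_algebra (borel_of (path_top p (Suc t) T))"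
    using problem assms by (auto simp: multistage_problem_def regular_conditional_probability_def)
  from measurable_compose[OF history_measurable_law this] show ?thesis
    using assms by simp
qed

lemma prob_space_kernel:
  assumes "t < T" "x \<in> space (law p)"
  shows "prob_space (kernel p t (history t x))"
    and "sets (kernel p t (history t x)) = sets (borel_of (path_top p (Suc t) T))"
    and "space (kernel p t (history t x)) = topspace (path_top p (Suc t) T)"
proof -
  have *: "kernel p t (history t x) \<in> space (prob_algebra (borel_of (path_top p (Suc t) T)))"
    using measurable_space[OF kernel_measurable[OF assms(1)] assms(2)] .
  then show "prob_space (kernel p t (history t x))"
    and sets: "sets (kernel p t (history t x)) = sets (borel_of (path_top p (Suc t) T))"
    by (auto simp: space_prob_algebra)
  show "space (kernel p t (history t x)) = topspace (path_top p (Suc t) T)"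
    using sets_eq_imp_space_eq[OF sets] by simp
qed

text \<open>Gluing depends on its first argument through the history, and merging coordinates is
  measurable on a product.\<close>
lemma glue_measurable:
  assumes "t \<le> T"
  shows "(\<lambda>(x, y). glue t x y) \<in> law p \<Otimes>\<^sub>M borel_of (path_top p (Suc t) T) \<rightarrow>\<^sub>M law p"
proof -
  let ?S = "\<lambda>i. borel_of (state_top p i)"
  have union: "{1..t} \<union> {Suc t..T} = {1..T}"
    using assms by auto
  have "merge {1..t} {Suc t..T} \<in> (\<Pi>\<^sub>M i\<in>{1..t}. ?S i) \<Otimes>\<^sub>M (\<Pi>\<^sub>M i\<in>{Suc t..T}. ?S i) \<rightarrow>\<^sub>M
      (\<Pi>\<^sub>M i\<in>{1..T}. ?S i)"
    using measurable_merge[of "{1..t}" "{Suc t..T}" ?S] unfolding union .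
  moreover have "sets (law p) = sets (\<Pi>\<^sub>M i\<in>{1..T}. ?S i)"
    by (simp add: sets_law sets_path_space)
  moreover have "sets (borel_of (path_top p 1 t) \<Otimes>\<^sub>M borel_of (path_top p (Suc t) T)) =
      sets ((\<Pi>\<^sub>M i\<in>{1..t}. ?S i) \<Otimes>\<^sub>M (\<Pi>\<^sub>M i\<in>{Suc t..T}. ?S i))"
    using assms by (intro sets_pair_measure_cong sets_path_space) auto
  ultimately have merge: "merge {1..t} {Suc t..T} \<in>
      borel_of (path_top p 1 t) \<Otimes>\<^sub>M borel_of (path_top p (Suc t) T) \<rightarrow>\<^sub>M law p"
    using measurable_cong_sets by blast
  have "(\<lambda>z. (history t (fst z), snd z)) \<in> law p \<Otimes>\<^sub>M borel_of (path_top p (Suc t) T) \<rightarrow>\<^sub>M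
      borel_of (path_top p 1 t) \<Otimes>\<^sub>M borel_of (path_top p (Suc t) T)"
    by (intro measurable_Pair measurable_compose[OF measurable_fst history_measurable_law] assms
        measurable_snd)
  from measurable_compose[OF this merge] show ?thesis
    by (simp only: glue_history case_prod_unfold)
qed

lemma glue_kernel_measurable:
  assumes "t < T"
  shows "(\<lambda>x. distr (kernel p t (history t x)) (law p) (glue t x)) \<in> law p \<rightarrow>\<^sub>M subprob_algebra (law p)"
  using assms by (intro measurable_distr2[OF glue_measurable] measurable_prob_algebraD
      kernel_measurable) auto

text \<open>The defining equation of a regular conditional probability is about events \<open>A \<times> B\<close>,
  where \<open>A\<close> concerns the first \<open>t\<close> coordinates and \<open>B\<close> the others. It extends to all events because
  two finite measures on a finite product agree once they agree on boxes, and a box is such an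
  event.\<close>
lemma law_disintegration:
  assumes t: "t < T"
  shows "law p = law p \<bind> (\<lambda>x. distr (kernel p t (history t x)) (law p) (glue t x))"
    (is "_ = law p \<bind> ?K")
proof (rule measure_eqI_PiM_finite)
  let ?S = "\<lambda>i. borel_of (state_top p i)"
  show "finite {1..T}" by simp
  show sets: "sets (law p) = sets (\<Pi>\<^sub>M i\<in>{1..T}. ?S i)"
    by (simp add: sets_law sets_path_space)
  have "sets (law p \<bind> ?K) = sets (law p)"
    using law.not_empty by simp
  then show "sets (law p \<bind> ?K) = sets (\<Pi>\<^sub>M i\<in>{1..T}. ?S i)"
    using sets by simp
  have "space (?S i) \<in> sets (?S i)" for i
    by (rule sets.top)
  then show "range (\<lambda>_::nat. \<Pi>\<^sub>E i\<in>{1..T}. space (?S i)) \<subseteq> prod_algebra {1..T} ?S"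
    by (auto simp del: space_borel_of intro!: prod_algebraI_finite)
  show "(\<Union>i::nat. \<Pi>\<^sub>E i\<in>{1..T}. space (?S i)) = space (\<Pi>\<^sub>M i\<in>{1..T}. ?S i)"
    by (simp add: space_PiM)
  show "emeasure (law p) (\<Pi>\<^sub>E i\<in>{1..T}. space (?S i)) \<noteq> \<infinity>"
    by (simp add: law.emeasure_eq_measure)
  fix A assume A: "\<And>i. i \<in> {1..T} \<Longrightarrow> A i \<in> sets (?S i)"
  define B where "B = (\<Pi>\<^sub>E i\<in>{1..t}. A i)"
  define C where "C = (\<Pi>\<^sub>E i\<in>{Suc t..T}. A i)"
  have B: "B \<in> sets (borel_of (path_top p 1 t))" and C: "C \<in> sets (borel_of (path_top p (Suc t) T))"
    using A t unfolding B_def C_def by (auto simp: sets_path_space intro!: sets_PiM_I_finite)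
  have E: "(\<Pi>\<^sub>E i\<in>{1..T}. A i) \<in> sets (law p)"
    unfolding sets using A by (intro sets_PiM_I_finite) auto
  have split: "x \<in> (\<Pi>\<^sub>E i\<in>{1..T}. A i) \<longleftrightarrow> x \<in> space (law p) \<and> history t x \<in> B \<and> restrict x {Suc t..T} \<in> C" for x
  proof -
    have "{1..T} = {1..t} \<union> {Suc t..T}"
      using t by auto
    moreover have "x \<in> space (law p)" if "x \<in> (\<Pi>\<^sub>E i\<in>{1..T}. A i)"
      using sets.sets_into_space[OF E] that by auto
    moreover have "x \<in> extensional {1..T}" if "x \<in> space (law p)"
      using that by (auto simp: space_law path_top_def PiE_iff)
    ultimately show ?thesis
      unfolding B_def C_def by (auto simp: PiE_iff history_def)
  qed
  have glue_mem: "glue t x y \<in> (\<Pi>\<^sub>E i\<in>{1..T}. A i) \<longleftrightarrow> history t x \<in> B \<and> y \<in> C"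
    if "x \<in> space (law p)" "y \<in> topspace (path_top p (Suc t) T)" for x y
  proof -
    have "restrict (glue t x y) {Suc t..T} = y"
      using that(2) by (auto simp: path_top_def merge_def fun_eq_iff PiE_iff extensional_def)
    then show ?thesis
      unfolding split using glue_in_space[OF that] history_glue[of t t x y] t by simp
  qed
  have "emeasure (law p \<bind> ?K) (\<Pi>\<^sub>E i\<in>{1..T}. A i) =
      (\<integral>\<^sup>+ x. emeasure (?K x) (\<Pi>\<^sub>E i\<in>{1..T}. A i) \<partial>law p)"
    using E by (intro emeasure_bind[OF law.not_empty glue_kernel_measurable[OF t]])
  also have "\<dots> = (\<integral>\<^sup>+ x. emeasure (kernel p t (history t x)) C * indicator {x. history t x \<in> B} x \<partial>law p)"
  proof (rule nn_integral_cong)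
    fix x assume x: "x \<in> space (law p)"
    have "glue t x \<in> borel_of (path_top p (Suc t) T) \<rightarrow>\<^sub>M law p"
      using measurable_compose[OF measurable_Pair1'[OF x] glue_measurable, of t] t by simp
    then have "glue t x \<in> kernel p t (history t x) \<rightarrow>\<^sub>M law p"
      using prob_space_kernel(2)[OF t x] by (simp cong: measurable_cong_sets)
    then have "emeasure (?K x) (\<Pi>\<^sub>E i\<in>{1..T}. A i) = emeasure (kernel p t (history t x))
        (glue t x -` (\<Pi>\<^sub>E i\<in>{1..T}. A i) \<inter> topspace (path_top p (Suc t) T))"
      using E by (simp add: emeasure_distr prob_space_kernel(3)[OF t x])
    also have "glue t x -` (\<Pi>\<^sub>E i\<in>{1..T}. A i) \<inter> topspace (path_top p (Suc t) T) =
        (if history t x \<in> B then C else {})"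
      using glue_mem[OF x] sets.sets_into_space[OF C] by auto
    finally show "emeasure (?K x) (\<Pi>\<^sub>E i\<in>{1..T}. A i) =
        emeasure (kernel p t (history t x)) C * indicator {x. history t x \<in> B} x"
      by simp
  qed
  also have "\<dots> = emeasure (law p) {x \<in> space (law p). history t x \<in> B \<and> restrict x {Suc t..T} \<in> C}"
    using problem t B C by (auto simp: multistage_problem_def regular_conditional_probability_def)
  also have "{x \<in> space (law p). history t x \<in> B \<and> restrict x {Suc t..T} \<in> C} = (\<Pi>\<^sub>E i\<in>{1..T}. A i)"
    using split by blast
  finally show "emeasure (law p) (\<Pi>\<^sub>E i\<in>{1..T}. A i) = emeasure (law p \<bind> ?K) (\<Pi>\<^sub>E i\<in>{1..T}. A i)"
    by simp
qed

lemma AE_kernel_iff: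
  assumes t: "t < T" and P: "Measurable.pred (law p) P"
  shows "(AE x in law p. P x) \<longleftrightarrow>
    (AE x in law p. AE y in kernel p t (history t x). P (glue t x y))"
proof -
  let ?K = "\<lambda>x. distr (kernel p t (history t x)) (law p) (glue t x)"
  have "(AE x in law p. P x) \<longleftrightarrow> (AE x in law p \<bind> ?K. P x)"
    by (rule arg_cong[OF law_disintegration[OF t], of "\<lambda>M. AE x in M. P x"])
  also have "\<dots> \<longleftrightarrow> (AE x in law p. AE y in ?K x. P y)"
    by (rule AE_bind[OF glue_kernel_measurable[OF t] P])
  also have "\<dots> \<longleftrightarrow> (AE x in law p. AE y in kernel p t (history t x). P (glue t x y))"
  proof (rule AE_cong)
    fix x assume x: "x \<in> space (law p)"
    have "glue t x \<in> borel_of (path_top p (Suc t) T) \<rightarrow>\<^sub>M law p"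
      using measurable_compose[OF measurable_Pair1'[OF x] glue_measurable, of t] t by simp
    then have "glue t x \<in> kernel p t (history t x) \<rightarrow>\<^sub>M law p"
      using prob_space_kernel(2)[OF t x] by (simp cong: measurable_cong_sets)
    then show "(AE y in ?K x. P y) \<longleftrightarrow> (AE y in kernel p t (history t x). P (glue t x y))"
      using P by (intro AE_distr_iff) auto
  qed
  finally show ?thesis .
qed

text \<open>Null sets of the law are null sets of almost every conditional law. The property \<open>P\<close> need not be
  an event: the equivalence for events is applied to a null set outside which \<open>P\<close> holds.\<close>
lemma AE_kernel:
  assumes t: "t < T" and P: "AE x in law p. P x"
  shows "AE x in law p. AE y in kernel p t (history t x). P (glue t x y)"
proof -
  obtain N where N: "{x \<in> space (law p). \<not> P x} \<subseteq> N" "N \<in> null_sets (law p)"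
    using P unfolding eventually_ae_filter by auto
  have "AE x in law p. x \<notin> N"
    using N(2) by (rule AE_not_in)
  moreover have "Measurable.pred (law p) (\<lambda>x. x \<notin> N)"
  proof -
    have [measurable]: "N \<in> sets (law p)"
      using N(2) by auto
    show ?thesis by measurable
  qed
  ultimately have "AE x in law p. AE y in kernel p t (history t x). glue t x y \<notin> N"
    using AE_kernel_iff[OF t] by blast
  with AE_space show ?thesis
  proof eventually_elim
    case (elim x)
    note x = elim(1)
    from elim(2) AE_space show ?case
    proof eventually_elim
      case (elim y)
      then have "glue t x y \<in> space (law p)"
        using x t prob_space_kernel(3)[OF t x] by (intro glue_in_space) auto
      with elim N(1) show ?case by auto
    qed
  qed
qed

section \<open>Nested risks\<close>
lemma nested_risk_refl [simp]: "nested_risk p t t Y = Y"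
  by (simp add: nested_risk_def)

lemma nested_risk_step:
  "t < u \<Longrightarrow> nested_risk p t u Y = cond_risk p t (nested_risk p (Suc t) u Y)"
  by (simp add: nested_risk_def upt_conv_Cons)

lemma nested_risk_compose:
  assumes "s \<le> t" "t \<le> u"
  shows "nested_risk p s t (nested_risk p t u Y) = nested_risk p s u Y"
proof -
  have "[s..<u] = [s..<t] @ [t..<u]"
    using assms upt_add_eq_append[of s t "u - t"] by simp
  then show ?thesis
    by (simp add: nested_risk_def)
qed

lemma cond_risk_cong:
  assumes t: "t < T" and x: "x \<in> space (law p)"
    and eq: "\<And>y. y \<in> space (law p) \<Longrightarrow> history t y = history t x \<Longrightarrow> Y y = Y' y"
  shows "cond_risk p t Y x = cond_risk p t Y' x"
proof -
  have "section_at p t Y x y = section_at p t Y' x y" if "y \<in> space (kernel p t (history t x))" for y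
    using that t x unfolding section_at_def
    by (intro eq glue_in_space) (simp_all add: prob_space_kernel(3) history_glue[of t t, simplified])
  then show ?thesis
    unfolding cond_risk_def by (intro SUP_cong refl risk_cong)
qed

text \<open>The conditional risk at \<open>x\<close> is evaluated on the section at \<open>x\<close>, which consists of paths with the
  same history. Hence the equality of nested risks holds at the given path and not only almost surely,
  which is what allows choosing a continuation separately for each history.\<close>
lemma nested_risk_cong:
  assumes "t \<le> u" "u \<le> T" and "x \<in> space (law p)"
    and "\<And>y. y \<in> space (law p) \<Longrightarrow> history t y = history t x \<Longrightarrow> Y y = Y' y"
  shows "nested_risk p t u Y x = nested_risk p t u Y' x"
  using assms(1,3,4)
proof (induction t arbitrary: x rule: inc_induct)
  case base
  then show ?case by simp
next
  case (step t)
  have "cond_risk p t (nested_risk p (Suc t) u Y) x = cond_risk p t (nested_risk p (Suc t) u Y') x"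
  proof (rule cond_risk_cong)
    fix y assume y: "y \<in> space (law p)" "history t y = history t x"
    show "nested_risk p (Suc t) u Y y = nested_risk p (Suc t) u Y' y"
    proof (rule step.IH[OF y(1)])
      fix y' assume y': "y' \<in> space (law p)" "history (Suc t) y' = history (Suc t) y"
      then have "history t y' = history t x"
        using y(2) history_history[of t "Suc t"] by (metis le_Suc_eq order_refl)
      with y'(1) show "Y y' = Y' y'"
        by (rule step.prems(2))
    qed
  qed (use step assms(2) in auto)
  then show ?case
    using step.hyps by (simp add: nested_risk_step)
qed

text \<open>The risks evaluated by the outer part of a composition are among those of the whole.\<close>
lemma nested_risk_well_defined_tail:
  assumes "nested_risk_well_defined p s u Y" "s \<le> t" "t \<le> u"
  shows "nested_risk_well_defined p s t (nested_risk p t u Y)"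
  using assms unfolding nested_risk_well_defined_def
  by (auto simp: nested_risk_compose Suc_le_eq)

text \<open>Monotonicity (\<open>\<epsilon> = 0\<close>) and translation in one statement, which is stable under induction over
  the stages.\<close>
lemma nested_risk_le_add:
  assumes t: "t \<le> T" and \<epsilon>: "0 \<le> \<epsilon>"
    and le: "AE x in law p. W x \<le> V x + ereal \<epsilon>"
    and V: "nested_risk_well_defined p s t V" and s: "s \<le> t"
  shows "AE x in law p. nested_risk p s t W x \<le> nested_risk p s t V x + ereal \<epsilon>"
proof -
  have "AE x in law p. nested_risk p r t W x \<le> nested_risk p r t V x + ereal \<epsilon>"
    if "r \<le> t" "s \<le> r" for r
    using that
  proof (induction r rule: inc_induct)
    case base
    then show ?case using le by simp
  next
    case (step r)
    then have r: "r < T" and sr: "s \<le> r" "r < t"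
      using t by auto
    let ?W = "nested_risk p (Suc r) t W" and ?V = "nested_risk p (Suc r) t V"
    have "AE x in law p. ?W x \<le> ?V x + ereal \<epsilon>"
      using step by simp
    then have "AE x in law p. AE y in kernel p r (history r x). ?W (glue r x y) \<le> ?V (glue r x y) + ereal \<epsilon>"
      by (rule AE_kernel[OF r])
    moreover have "AE x in law p. \<forall>\<sigma>\<in>distortions p (Suc r).
        risk_well_defined (kernel p r (history r x)) \<sigma> (section_at p r ?V x)"
      using V sr by (auto simp: nested_risk_well_defined_def)
    ultimately have "AE x in law p. cond_risk p r ?W x \<le> cond_risk p r ?V x + ereal \<epsilon>"
    proof eventually_elim
      case (elim x)
      let ?risk = "risk (kernel p r (history r x))"
      show ?case
        unfolding cond_risk_def
      proof (rule SUP_least)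
        fix \<sigma> assume \<sigma>: "\<sigma> \<in> distortions p (Suc r)"
        have "?risk \<sigma> (section_at p r ?W x) \<le> ?risk \<sigma> (\<lambda>y. section_at p r ?V x y + ereal \<epsilon>)"
          using elim(1) by (intro risk_mono_AE) (simp add: section_at_def)
        also have "\<dots> \<le> ?risk \<sigma> (section_at p r ?V x) + ereal \<epsilon>"
          using elim(2) \<sigma> \<epsilon> by (intro risk_add_const_le) auto
        also have "\<dots> \<le> (SUP \<sigma>\<in>distortions p (Suc r). ?risk \<sigma> (section_at p r ?V x)) + ereal \<epsilon>"
          using \<sigma> by (intro add_right_mono SUP_upper)
        finally show "?risk \<sigma> (section_at p r ?W x) \<le>
          (SUP \<sigma>\<in>distortions p (Suc r). ?risk \<sigma> (section_at p r ?V x)) + ereal \<epsilon>" .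
      qed
    qed
    then show ?case
      using sr by (simp add: nested_risk_step)
  qed
  then show ?thesis
    using s by simp
qed

lemma nested_risk_top:
  assumes t: "t \<le> T" and V: "AE x in law p. V x = \<infinity>" and s: "s \<le> t"
  shows "AE x in law p. nested_risk p s t V x = \<infinity>"
  using s
proof (induction s rule: inc_induct)
  case base
  then show ?case using V by simp
next
  case (step r)
  then have r: "r < T"
    using t by simp
  obtain \<sigma> where \<sigma>: "\<sigma> \<in> distortions p (Suc r)" "distortion \<sigma>"
    using distortions_stage[OF r] by blast
  from AE_kernel[OF r step.IH] AE_space
  have "AE x in law p. cond_risk p r (nested_risk p (Suc r) t V) x = \<infinity>"
  proof eventually_elim
    case (elim x)
    have "risk (kernel p r (history r x)) \<sigma> (section_at p r (nested_risk p (Suc r) t V) x) = \<infinity>"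
      using elim(1) by (intro risk_top prob_space_kernel r elim(2) \<sigma>(2)) (simp add: section_at_def)
    moreover have "risk (kernel p r (history r x)) \<sigma> (section_at p r (nested_risk p (Suc r) t V) x)
        \<le> cond_risk p r (nested_risk p (Suc r) t V) x"
      unfolding cond_risk_def using \<sigma>(1) by (rule SUP_upper)
    ultimately show ?case by simp
  qed
  then show ?case
    using step.hyps by (simp add: nested_risk_step)
qed

text \<open>Well-definedness of the innermost risk, at the density 1, excludes \<open>-\<infinity>\<close> almost surely under
  almost every conditional law, and so almost surely under the law itself.\<close>
lemma nested_risk_well_defined_AE_not_MInfty:
  assumes "s < t" "t \<le> T" and V: "nested_risk_well_defined p s t V"
  shows "AE x in law p. V x \<noteq> -\<infinity>"
proof -
  define r where "r = t - 1"
  have r: "r < T" "s \<le> r" "r < t" "Suc r = t"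
    using assms by (auto simp: r_def)
  obtain \<sigma> where \<sigma>: "\<sigma> \<in> distortions p (Suc r)" "distortion \<sigma>"
    using distortions_stage[OF r(1)] by blast
  have "V \<in> borel_measurable (stage_algebra p t)"
    using V assms(1) by (auto simp: nested_risk_well_defined_def dest: bspec[of _ _ t])
  then have "V \<in> borel_measurable (law p)"
    using measurable_mono[OF order_refl refl sets_stage_algebra_subset_law[OF assms(2)], of borel]
    by (auto simp: space_stage_algebra)
  then have pred: "Measurable.pred (law p) (\<lambda>x. V x \<noteq> -\<infinity>)"
    by measurable
  have "AE x in law p. \<forall>\<sigma>\<in>distortions p (Suc r).
      risk_well_defined (kernel p r (history r x)) \<sigma> (section_at p r V x)"
    using V r(2-4) by (auto simp: nested_risk_well_defined_def dest: bspec[of _ _ r])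
  with AE_space have "AE x in law p. AE y in kernel p r (history r x). V (glue r x y) \<noteq> -\<infinity>"
  proof eventually_elim
    case (elim x)
    then have "AE y in kernel p r (history r x). section_at p r V x y \<noteq> -\<infinity>"
      using \<sigma> by (intro risk_well_defined_AE_not_MInfty[OF prob_space_kernel(1)[OF r(1)] \<sigma>(2)]) auto
    then show ?case
      by (simp only: section_at_def)
  qed
  then show ?thesis
    using AE_kernel_iff[OF r(1) pred] by simp
qed

section \<open>Adapted policies\<close>
lemma adapted_restrict:
  assumes "adapted p s u z" "s \<le> s'" "u' \<le> u"
  shows "adapted p s' u' z"
proof -
  have "{s'..<u'} \<subseteq> {s..<u}"
    using assms by auto
  then show ?thesis
    using assms(1) unfolding adapted_def by blast
qed

lemma adapted_join:
  assumes z: "adapted p a s z" and z': "adapted p s u z'"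
  shows "adapted p a u (join_policy s z z')"
  unfolding adapted_def
proof (rule ballI)
  fix j assume j: "j \<in> {a..<u}"
  show "join_policy s z z' j \<in> stage_algebra p j \<rightarrow>\<^sub>M borel_of (decision_top p j) \<and>
    (\<forall>x\<in>space (law p). \<forall>y\<in>space (law p).
      history j x = history j y \<longrightarrow> join_policy s z z' j x = join_policy s z z' j y)"
  proof (cases "j < s")
    case True
    then have eq: "join_policy s z z' j = z j"
      by (simp add: join_policy_def fun_eq_iff)
    show ?thesis
      unfolding eq by (rule bspec[OF z[unfolded adapted_def]]) (use j True in simp)
  next
    case False
    then have eq: "join_policy s z z' j = z' j"
      by (simp add: join_policy_def fun_eq_iff)
    show ?thesis
      unfolding eq by (rule bspec[OF z'[unfolded adapted_def]]) (use j False in simp)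
  qed
qed

lemma join_policy_assoc:
  "s \<le> t \<Longrightarrow> join_policy t (join_policy s z z1) z2 = join_policy s z (join_policy t z1 z2)"
  by (auto simp: join_policy_def fun_eq_iff)

lemma join_policy_same [simp]: "join_policy t z z = z"
  by (auto simp: join_policy_def fun_eq_iff)

lemma join_policy_0 [simp]: "join_policy 0 z z' = z'"
  by (auto simp: join_policy_def fun_eq_iff)

text \<open>At stage \<open>t\<close> one of countably many continuations is chosen by a rule that is known at that
  stage, and then followed to the end; later decisions may depend on the choice, since the stage
  algebras increase.\<close>
lemma adapted_switch:
  assumes Z: "\<And>n. adapted p t u (Z n)" and u: "u \<le> Suc T"
    and N: "N \<in> stage_algebra p t \<rightarrow>\<^sub>M count_space (UNIV :: nat set)"
  shows "adapted p t u (\<lambda>j x. Z (N x) j x)"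
  unfolding adapted_def
proof (intro ballI conjI impI)
  fix j assume j: "j \<in> {t..<u}"
  then have jT: "j \<le> T" "t \<le> j" "t \<le> T"
    using u by auto
  have Z_j: "Z n j \<in> stage_algebra p j \<rightarrow>\<^sub>M borel_of (decision_top p j) \<and>
    (\<forall>x\<in>space (law p). \<forall>y\<in>space (law p). history j x = history j y \<longrightarrow> Z n j x = Z n j y)" for n
    by (rule bspec[OF Z[unfolded adapted_def] j])
  show "(\<lambda>x. Z (N x) j x) \<in> stage_algebra p j \<rightarrow>\<^sub>M borel_of (decision_top p j)"
    by (rule measurable_compose_countable[where f = "\<lambda>n. Z n j"])
      (use Z_j measurable_stage_algebra_mono[OF N jT(2,1)] in blast)+
  fix x y assume xy: "x \<in> space (law p)" "y \<in> space (law p)" "history j x = history j y"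
  then have "history t x = history t y"
    using history_history[OF jT(2)] xy(3) by metis
  then have "N y = N x"
    by (rule stage_measurable_history[OF N jT(3) _ xy(1,2), rotated]) simp
  moreover have "Z (N x) j x = Z (N x) j y"
    using Z_j[of "N x"] xy by blast
  ultimately show "Z (N x) j x = Z (N y) j y"
    by simp
qed

end

section \<open>The value process\<close>
locale well_posed_multistage_program = multistage_program p
  for p :: "('a, 'b) multistage" +
  assumes policy_well_defined:
      "adapted p 0 (Suc (horizon p)) z \<Longrightarrow>
         nested_risk_well_defined p 0 (horizon p) (policy_cost p z)"
    and value_well_defined:
      "t \<le> horizon p \<Longrightarrow> adapted p 0 t z \<Longrightarrow>
         nested_risk_well_defined p 0 t (value_process p t z)"
begin

abbreviation continuation_risk ::
    "nat \<Rightarrow> (nat \<Rightarrow> (nat \<Rightarrow> 'a) \<Rightarrow> 'b) \<Rightarrow> (nat \<Rightarrow> (nat \<Rightarrow> 'a) \<Rightarrow> 'b) \<Rightarrow> (nat \<Rightarrow> 'a) \<Rightarrow> ereal" where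
  "continuation_risk t z z' \<equiv> nested_risk p t T (policy_cost p (join_policy t z z'))"

abbreviation continuation_risks ::
    "nat \<Rightarrow> (nat \<Rightarrow> (nat \<Rightarrow> 'a) \<Rightarrow> 'b) \<Rightarrow> ((nat \<Rightarrow> 'a) \<Rightarrow> ereal) set" where
  "continuation_risks t z \<equiv> {continuation_risk t z z' | z'. adapted p t (Suc T) z'}"

lemma continuation_risk_measurable:
  assumes "t \<le> T" "adapted p 0 t z" "adapted p t (Suc T) z'"
  shows "continuation_risk t z z' \<in> borel_measurable (stage_algebra p t)"
  using policy_well_defined[OF adapted_join[OF assms(2,3)]] assms(1)
  by (simp add: nested_risk_well_defined_def)

lemma continuation_risks_countable_INF:
  assumes "t \<le> T" "adapted p 0 t z"
  obtains C where "countable C" "C \<subseteq> continuation_risks t z"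
    "is_ess_inf (law p) (stage_algebra p t) (continuation_risks t z) (\<lambda>x. INF f\<in>C. f x)"
proof (rule is_ess_inf_countable_INF)
  show "finite_measure (law p)"
    by unfold_locales
  show "continuation_risks t z \<subseteq> borel_measurable (stage_algebra p t)"
    using continuation_risk_measurable[OF assms] by blast
qed (use assms(1) in \<open>auto simp: space_stage_algebra dest: sets_stage_algebra_subset_law intro: that\<close>)

lemma is_ess_inf_value_process:
  assumes "t \<le> T" "adapted p 0 t z"
  shows "is_ess_inf (law p) (stage_algebra p t) (continuation_risks t z) (value_process p t z)"
  unfolding value_process_def
  by (rule continuation_risks_countable_INF[OF assms]) (rule is_ess_inf_ess_inf)

text \<open>The infimum over countably many continuation risks is approached within \<open>\<epsilon>\<close> wherever it is not
  \<open>-\<infinity>\<close>. The first continuation of the sequence which does so is selected. The assumption \<open>0 < t\<close> serves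
  to exclude \<open>-\<infinity>\<close>: at stage 0 no risk is evaluated that would do so.\<close>
lemma near_optimal_continuation:
  assumes t: "0 < t" "t \<le> T" and z: "adapted p 0 t z" and z0: "adapted p t (Suc T) z0"
    and \<epsilon>: "0 < \<epsilon>"
  obtains z' where "adapted p t (Suc T) z'"
    "AE x in law p. continuation_risk t z z' x \<le> value_process p t z x + ereal \<epsilon>"
proof -
  let ?v = "value_process p t z"
  have v: "is_ess_inf (law p) (stage_algebra p t) (continuation_risks t z) ?v"
    using is_ess_inf_value_process[OF t(2) z] .
  obtain C where C: "countable C" "C \<subseteq> continuation_risks t z"
    and C_inf: "is_ess_inf (law p) (stage_algebra p t) (continuation_risks t z) (\<lambda>x. INF f\<in>C. f x)"
    by (rule continuation_risks_countable_INF[OF t(2) z])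
  \<comment> \<open>The countable subfamily may be empty; a sequence needs at least one member.\<close>
  define D where "D = insert (continuation_risk t z z0) C"
  have D: "countable D" "D \<noteq> {}" "D \<subseteq> continuation_risks t z"
    using C z0 by (auto simp: D_def)
  have "\<forall>n. \<exists>z'. adapted p t (Suc T) z' \<and> from_nat_into D n = continuation_risk t z z'"
    using from_nat_into[OF D(2)] D(3) by blast
  then obtain Z where Z: "\<And>n. adapted p t (Suc T) (Z n)"
    "\<And>n. from_nat_into D n = continuation_risk t z (Z n)"
    by metis
  define N where "N x = (LEAST n. continuation_risk t z (Z n) x \<le> ?v x + ereal \<epsilon>)" for x
  have N: "N \<in> stage_algebra p t \<rightarrow>\<^sub>M count_space UNIV"
    unfolding N_def
  proof (rule measurable_Least)
    show "Measurable.pred (stage_algebra p t) (\<lambda>x. continuation_risk t z (Z n) x \<le> ?v x + ereal \<epsilon>)" for n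
      unfolding Measurable.pred_def
      by (intro borel_measurable_le borel_measurable_ereal_add borel_measurable_const
          is_ess_inf_measurable[OF v] continuation_risk_measurable[OF t(2) z Z(1)])
  qed
  let ?z = "\<lambda>j x. Z (N x) j x"
  \<comment> \<open>Paths with the same history select the same continuation, so that locality applies.\<close>
  have switch: "continuation_risk t z ?z x = continuation_risk t z (Z (N x)) x"
    if x: "x \<in> space (law p)" for x
  proof (rule nested_risk_cong[OF t(2) order_refl x])
    fix y assume "y \<in> space (law p)" "history t y = history t x"
    then have "N y = N x"
      by (intro stage_measurable_history[OF N t(2) _ x]) simp_all
    then show "policy_cost p (join_policy t z ?z) y = policy_cost p (join_policy t z (Z (N x))) y"
      by (simp add: policy_cost_def join_policy_def if_distrib[of "\<lambda>f. f y"] cong: if_cong)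
  qed
  have "AE x in law p. ?v x \<noteq> -\<infinity>"
    using nested_risk_well_defined_AE_not_MInfty[OF t value_well_defined[OF t(2) z]] .
  with is_ess_inf_unique[OF v C_inf] AE_space
  have "AE x in law p. continuation_risk t z ?z x \<le> ?v x + ereal \<epsilon>"
  proof eventually_elim
    case (elim x)
    have "\<exists>n. continuation_risk t z (Z n) x \<le> ?v x + ereal \<epsilon>"
    proof (cases "?v x = \<infinity>")
      case False
      then have "?v x < ?v x + ereal \<epsilon>"
        using elim(3) \<epsilon> by (cases "?v x") auto
      then have "(INF f\<in>C. f x) < ?v x + ereal \<epsilon>"
        using elim(1) by simp
      then obtain f where "f \<in> C" "f x < ?v x + ereal \<epsilon>"
        by (auto simp: INF_less_iff)
      moreover from this(1) obtain n where "f = from_nat_into D n"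
        using D(1) from_nat_into_surj[of D f] by (auto simp: D_def)
      ultimately show ?thesis
        using Z(2) by (auto intro!: exI[of _ n])
    qed auto
    then have "continuation_risk t z (Z (N x)) x \<le> ?v x + ereal \<epsilon>"
      unfolding N_def by (rule LeastI_ex)
    with switch[OF elim(2)] show ?case
      by simp
  qed
  with adapted_switch[OF Z(1) order_refl N] show thesis
    by (rule that)
qed

text \<open>Continuing \<open>z'\<close> with a near-optimal policy after stage \<open>t\<close> costs at most \<open>\<epsilon>\<close> more than
  \<open>R\<^sub>s\<^sub>,\<^sub>t(v\<^sub>t)\<close>.\<close>
lemma value_process_le_nested_risk:
  assumes st: "s < t" "t \<le> T" and z: "adapted p 0 s z" and z': "adapted p s t z'"
  shows "AE x in law p. value_process p s z x \<le>
    nested_risk p s t (value_process p t (join_policy s z z')) x"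
proof -
  let ?z = "join_policy s z z'"
  let ?v = "value_process p t ?z"
  have z_join: "adapted p 0 t ?z"
    using adapted_join[OF z z'] .
  note v = is_ess_inf_value_process[OF st(2) z_join]
  show ?thesis
  \<comment> \<open>A decision space may be empty. Then \<open>v\<^sub>t\<close> is the infimum of the empty family.\<close>
  proof (cases "\<exists>z0. adapted p t (Suc T) z0")
    case False
    then have "AE x in law p. \<infinity> \<le> ?v x"
      by (intro is_ess_inf_greatest[OF v]) auto
    then have "AE x in law p. ?v x = \<infinity>"
      by eventually_elim simp
    from nested_risk_top[OF st(2) this, of s] st show ?thesis
      by (auto elim: eventually_mono)
  next
    case True
    then obtain z0 where z0: "adapted p t (Suc T) z0" ..
    have wd: "nested_risk_well_defined p s t ?v"
      using value_well_defined[OF st(2) z_join] by (auto simp: nested_risk_well_defined_def)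
    have "AE x in law p. value_process p s z x \<le> nested_risk p s t ?v x + ereal \<epsilon>" if \<epsilon>: "0 < \<epsilon>" for \<epsilon>
    proof -
      have "0 < t"
        using st by simp
      then obtain z'' where z'': "adapted p t (Suc T) z''"
        and le: "AE x in law p. continuation_risk t ?z z'' x \<le> ?v x + ereal \<epsilon>"
        by (rule near_optimal_continuation[OF _ st(2) z_join z0 \<epsilon>])
      have "adapted p s (Suc T) (join_policy t z' z'')"
        using adapted_join[OF z' z''] .
      then have "AE x in law p. value_process p s z x \<le> continuation_risk s z (join_policy t z' z'') x"
        using st z by (intro is_ess_inf_lower[OF is_ess_inf_value_process]) auto
      moreover have "continuation_risk s z (join_policy t z' z'') =
          nested_risk p s t (continuation_risk t ?z z'')"
        using st by (simp add: nested_risk_compose join_policy_assoc)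
      moreover have "AE x in law p. nested_risk p s t (continuation_risk t ?z z'') x \<le>
          nested_risk p s t ?v x + ereal \<epsilon>"
        using st \<epsilon> by (intro nested_risk_le_add[OF st(2) _ le wd]) auto
      ultimately show ?thesis
        by (auto elim: eventually_elim2)
    qed
    then have "AE x in law p. \<forall>n. value_process p s z x \<le>
        nested_risk p s t ?v x + ereal (inverse (real (Suc n)))"
      unfolding AE_all_countable by simp
    then show ?thesis
    proof eventually_elim
      case (elim x)
      have "value_process p s z x \<le> nested_risk p s t ?v x + ereal e" if "0 < e" for e
      proof -
        obtain n where "inverse (real (Suc n)) < e"
          using reals_Archimedean[OF \<open>0 < e\<close>] by blast
        then have "nested_risk p s t ?v x + ereal (inverse (real (Suc n))) \<le>
            nested_risk p s t ?v x + ereal e"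
          by (intro add_left_mono) simp
        with elim show ?thesis
          using order_trans by blast
      qed
      then show ?case
        by (rule ereal_le_epsilon2)
    qed
  qed
qed

text \<open>That \<open>v\<^sub>s\<close> is the greatest lower bound is the inequality by monotonicity: a lower bound of all
  \<open>R\<^sub>s\<^sub>,\<^sub>t(v\<^sub>t)\<close> is one of all \<open>R\<^sub>s\<^sub>,\<^sub>T(Q)\<close>, where the policy before stage \<open>t\<close> is the initial part of the
  whole policy.\<close>
lemma is_ess_inf_value_process_recursion:
  assumes st: "s < t" "t \<le> T" and z: "adapted p 0 s z"
  shows "is_ess_inf (law p) (stage_algebra p s)
    {nested_risk p s t (value_process p t (join_policy s z z')) | z'. adapted p s t z'}
    (value_process p s z)"
  unfolding is_ess_inf_def
proof (intro conjI ballI impI)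
  have "s \<le> T"
    using st by simp
  note v = is_ess_inf_value_process[OF this z]
  show "value_process p s z \<in> borel_measurable (stage_algebra p s)"
    by (rule is_ess_inf_measurable[OF v])
  show "AE x in law p. value_process p s z x \<le> f x"
    if "f \<in> {nested_risk p s t (value_process p t (join_policy s z z')) | z'. adapted p s t z'}" for f
    using that value_process_le_nested_risk[OF st z] by blast
  fix w :: "(nat \<Rightarrow> 'a) \<Rightarrow> ereal"
  assume w: "w \<in> borel_measurable (stage_algebra p s)"
    and lower: "\<forall>f\<in>{nested_risk p s t (value_process p t (join_policy s z z')) | z'. adapted p s t z'}.
      AE x in law p. w x \<le> f x"
  show "AE x in law p. w x \<le> value_process p s z x"
  proof (rule is_ess_inf_greatest[OF v w])
    fix f assume "f \<in> continuation_risks s z"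
    then obtain z' where z': "adapted p s (Suc T) z'" and f: "f = continuation_risk s z z'"
      by blast
    let ?z = "join_policy s z z'"
    have s_t: "adapted p s t z'" and t_T: "adapted p t (Suc T) z'"
      using adapted_restrict[OF z'] st by auto
    have z_join: "adapted p 0 t ?z"
      using adapted_join[OF z s_t] .
    have tail: "continuation_risk t ?z z' = nested_risk p t T (policy_cost p ?z)"
      using st by (simp add: join_policy_assoc)
    then have f_tail: "f = nested_risk p s t (continuation_risk t ?z z')"
      using st by (simp add: f nested_risk_compose)
    have "AE x in law p. value_process p t ?z x \<le> continuation_risk t ?z z' x + ereal 0"
      using is_ess_inf_lower[OF is_ess_inf_value_process[OF st(2) z_join]] t_T by auto
    moreover have "nested_risk_well_defined p s t (continuation_risk t ?z z')"
      unfolding tail using policy_well_defined[OF adapted_join[OF z z']] st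
      by (intro nested_risk_well_defined_tail) (auto simp: nested_risk_well_defined_def)
    ultimately have "AE x in law p. nested_risk p s t (value_process p t ?z) x \<le> f x + ereal 0"
      unfolding f_tail using st by (intro nested_risk_le_add) auto
    moreover have "AE x in law p. w x \<le> nested_risk p s t (value_process p t ?z) x"
      using lower s_t by blast
    ultimately show "AE x in law p. w x \<le> f x"
      by eventually_elim simp
  qed
qed

lemma INF_eq_of_is_ess_inf_0:
  assumes "is_ess_inf (law p) (stage_algebra p 0) A v" "A \<subseteq> borel_measurable (stage_algebra p 0)"
    "x \<in> space (law p)"
  shows "v x = (INF f\<in>A. f x)"
  using prob_space_law space_stage_algebra stage_algebra_0_const assms(2,1,3)
  by (rule is_ess_inf_trivial_algebra)

lemma optimal_value_eq_value_process_0: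
  assumes x: "x \<in> space (law p)"
  shows "optimal_value p x = value_process p 0 z x"
proof -
  have z: "adapted p 0 0 z"
    by (simp add: adapted_def)
  have "value_process p 0 z x = (INF f\<in>continuation_risks 0 z. f x)"
    using is_ess_inf_value_process[OF _ z] continuation_risk_measurable[OF _ z] x
    by (intro INF_eq_of_is_ess_inf_0) auto
  also have "\<dots> = optimal_value p x"
    unfolding optimal_value_def by (intro INF_eq) auto
  finally show ?thesis ..
qed

text \<open>For \<open>t = 0\<close> there are no decisions and no risks before stage \<open>t\<close>, and the infimum runs over equal
  values. For \<open>t > 0\<close> this is the recursion from stage 0, where essential infima are pointwise.\<close>
lemma optimal_value_recursion:
  assumes t: "t \<le> T" and x: "x \<in> space (law p)"
  shows "optimal_value p x =
    (INF z\<in>{z. adapted p 0 t z}. nested_risk p 0 t (value_process p t z) x)"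
proof (cases "t = 0")
  case True
  then show ?thesis
    using optimal_value_eq_value_process_0[OF x] by (simp add: adapted_def)
next
  case False
  fix z :: "nat \<Rightarrow> (nat \<Rightarrow> 'a) \<Rightarrow> 'b"
  have z: "adapted p 0 0 z"
    by (simp add: adapted_def)
  let ?A = "{nested_risk p 0 t (value_process p t (join_policy 0 z z')) | z'. adapted p 0 t z'}"
  have "?A \<subseteq> borel_measurable (stage_algebra p 0)"
    using value_well_defined[OF t] by (auto simp: nested_risk_well_defined_def)
  then have "value_process p 0 z x = (INF f\<in>?A. f x)"
    using is_ess_inf_value_process_recursion[OF _ t z] False x by (intro INF_eq_of_is_ess_inf_0) auto
  also have "\<dots> = (INF z\<in>{z. adapted p 0 t z}. nested_risk p 0 t (value_process p t z) x)"
    by (intro INF_eq) auto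
  finally show ?thesis
    using optimal_value_eq_value_process_0[OF x] by simp
qed

end

theorem theorem47:
  fixes p :: "('a, 'b) multistage"
  assumes "multistage_problem p"
    and "\<And>z. adapted p 0 (Suc (horizon p)) z \<Longrightarrow>
           nested_risk_well_defined p 0 (horizon p) (policy_cost p z)"
    and "\<And>t z. t \<le> horizon p \<Longrightarrow> adapted p 0 t z \<Longrightarrow>
           nested_risk_well_defined p 0 t (value_process p t z)"
  shows "(\<forall>t\<le>horizon p. \<forall>x\<in>space (law p).
            optimal_value p x =
              (INF z\<in>{z. adapted p 0 t z}. nested_risk p 0 t (value_process p t z) x)) \<and>
         (\<forall>s t z. s < t \<and> t \<le> horizon p \<and> adapted p 0 s z \<longrightarrow>
            (AE x in law p. value_process p s z x =
               ess_inf (law p) (stage_algebra p s)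
                 {nested_risk p s t (value_process p t (join_policy s z z')) | z'. adapted p s t z'} x))"
proof -
  interpret well_posed_multistage_program p
    using assms by unfold_locales
  show ?thesis
    using optimal_value_recursion
      is_ess_inf_unique[OF _ is_ess_inf_ess_inf, OF is_ess_inf_value_process_recursion
        is_ess_inf_value_process_recursion]
    by blast
qed

end
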